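(* For any starting point $(x^0,\lambda^0)\in\mathcal X\times\mathbb R^n_+$, denote by $\overline C_{\mathsf{det}}$ the (primal) oracle complexity of the deterministic IPDS algorithm (with the parameters and sub-problem solver described in the context), applied to the Lagrangian problem, to obtain an $\varepsilon$-optimal and $\varepsilon$-feasible solution of the constrained problem. Then $$\overline C_{\mathsf{det}}=O\bigg(\frac{nM}{\sqrt{\mu\varepsilon}}\sqrt{(L+\alpha)/\mu}\;\log\bigg(\frac{L+\alpha}{\varepsilon}\bigg)\bigg).$$
   Context: Constrained problem: $\min_{x\in\mathcal X}f(x)+r(x)$ subject to $g_i(x)\le0$, $i=1,\dots,n$, where $\mathcal X\subseteq\mathbb R^d$ is nonempty, convex, compact with diameter $D_{\mathcal X}$ ($\mathbb R^d$ carries some norm $\|\cdot\|$ with dual norm $\|\cdot\|_*$), $f$ is $\mu$-strongly convex and $L$-smooth on $\mathcal X$ ($L\ge\mu>0$), $r$ is convex, closed, proper with $\mathcal X\subseteq\mathrm{dom}\,r$ and admits a distance generating function (DGF) $\overline\omega$ on $\mathcal X$ (convex, closed, proper, essentially smooth, $1$-strongly convex and continuous on $\mathcal X$, with $\min_{x\in\mathcal X}r(x)+\langle\upsilon,x\rangle+a^{-1}\overline\omega(x)$ having an easily computable unique solution in $\mathcal X^o:=\mathcal X\cap\mathrm{int}\,\mathrm{dom}\,\overline\omega$ for all $a>0$ and $\upsilon$), and each $g_i$ is convex and $\alpha_i$-smooth on $\mathcal X$. There is a Slater point in $\mathcal X^o$ at which all $g_i<0$. Let $x^*$ be the unique optimal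 solution. $\bar x\in\mathcal X$ is $\varepsilon$-optimal and $\varepsilon$-feasible if $(f+r)(\bar x)-(f+r)(x^* )\le\varepsilon$ and $[g_i(\bar x)]_+\le\varepsilon$ for all $i$, where $[a]_+:=\max\{a,0\}$. Lagrangian: $S(x,\lambda):=f(x)+r(x)+\sum_{i=1}^n\lambda_ig_i(x)$ on $\mathcal X\times\mathbb R^n_+$, with saddle point $(x^*,\lambda^* )$; $\psi^{\mathrm D}(\lambda):=\inf_{x\in\mathcal X}S(x,\lambda)$; $\Delta_\rho(x,\lambda):=\sup_{\lambda'\in\mathbb R^n_+}\{S(x,\lambda')-\frac\rho2\|\lambda'\|_2^2\}-\psi^{\mathrm D}(\lambda)$. $M_i:=\alpha_iD_{\mathcal X}+\inf_{x\in\mathcal X}\|\nabla g_i(x)\|_*$, $M:=\sum_{i=1}^nM_i$, $L_{\mathrm D}:=M^2/\mu>0$, $\alpha:=\sum_{i=1}^n\alpha_i$, $L_{xx}(\lambda):=\sum_{i=1}^n\lambda_i\alpha_i$. Primal oracle: returns $\nabla f(x)$ on input $(x,0)$ and $\lambda_i\nabla g_i(x)$ (up to normalization) on input $(x,\lambda,i)$; the oracle complexity is the number of calls. Deterministic IPDS algorithm (specialized). Parameters $\rho_0=8L_{\mathrm D}$, $\tau_k=\frac{k+1}{k+3}$, $\gamma_k=\frac{\varepsilon}{4(k+3)}$, $\eta_k=0$. With $\widetilde\lambda_{\rho,0}(x):=([g_i(x)]_+/\rho)_{i=1}^n$ (the exact solution of $\max_{\lambda\in\mathbb R^n_+}\sum_i\lambda_ig_i(x)-\frac\rho2\|\lambda\|_2^2$),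 for $k=0,1,\dots$: $\hat\lambda^k=\tau_k\lambda^k+(1-\tau_k)\widetilde\lambda_{\rho_k,0}(x^k)$; find $\widetilde x_{\gamma_k}(\hat\lambda^k)\in\mathcal X$ with $S(\widetilde x_{\gamma_k}(\hat\lambda^k),\hat\lambda^k)-\psi^{\mathrm D}(\hat\lambda^k)\le\gamma_k$; $x^{k+1}=\tau_kx^k+(1-\tau_k)\widetilde x_{\gamma_k}(\hat\lambda^k)$; $\rho_{k+1}=\tau_k\rho_k$; $\lambda^{k+1}=\tau_k\lambda^k+(1-\tau_k)\widetilde\lambda_{\rho_{k+1},0}(x^{k+1})$. Sub-problem solver. $\widetilde x_{\gamma_k}(\hat\lambda^k)$ is computed by the accelerated proximal gradient method (APG). For $\min_{u\in\mathcal U}\Psi(u)=\phi_1(u)+\phi_2(u)$ with $\mathcal U$ convex compact, $\phi_1$ convex and $L'$-smooth on $\mathcal U$, $\Psi$ $\mu'$-strongly convex, $\phi_2$ convex with DGF $\pi$, $\kappa'=L'/\mu'$, minimizer $u^*$, its known guarantee from $u^0\in\mathcal U\cap\mathrm{int}\,\mathrm{dom}\,\pi$ is $\Psi(u^N)-\Psi(u^* )\le\frac{L'}4(1+1/\sqrt{2\kappa'})^{-2(N-1)}D_{\mathcal U,\pi}(u^0)$, $D_{\mathcal U,\pi}(u^0)=\max_{u\in\mathcal U}[\pi(u)-\pi(u^0)-\langle\nabla\pi(u^0),u-u^0\rangle]<\infty$; so accuracy $e$ is reached after a pre-determined number $O(\sqrt{\kappa'}\log(L'/e))$ of iterations. Here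 $\phi_1=f+\sum_i\hat\lambda^k_ig_i$, $\phi_2=r$, $L'=L+L_{xx}(\hat\lambda^k)$, $\mu'=\mu$; each iteration costs $n+1$ primal oracle calls; a fixed starting point in $\mathcal X^o$ is used. $O(\cdot)$ convention: $\varepsilon\to0$, i.e. the bound holds for all sufficiently small $\varepsilon>0$ (threshold depending on the other data); the implied constant may depend on $\lambda^0$, $\lambda^*$ and $[\Delta_{\rho_0}(x^0,\lambda^0)]_+/L_{\mathrm D}$. *)

theory Defs
  imports "HOL-Analysis.Analysis"
begin

text \<open>
  The space \<open>\<real>\<^sup>d\<close> is rendered as a finite-dimensional subspace \<open>E\<close> of an arbitrary real inner
  product space \<open>'v\<close>, and not as a type of class \<open>euclidean_space\<close>: in this way an implied
  constant can be quantified before \<open>E\<close>, that is, independently of the dimension \<open>d\<close>.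
  Differentiability, interiors and boundaries are those of \<open>E\<close>. The inner product of \<open>'v\<close> is the
  duality pairing and its topology is the usual one of \<open>\<real>\<^sup>d\<close>; lengths are measured in a
  norm \<open>N\<close> on \<open>E\<close> unrelated to the inner product.
\<close>

definition findim_subspace :: "'v::real_inner set \<Rightarrow> bool" where
  "findim_subspace E \<longleftrightarrow> (\<exists>B. finite B \<and> E = span B)"

definition norm_on :: "'v::real_inner set \<Rightarrow> ('v \<Rightarrow> real) \<Rightarrow> bool" where
  "norm_on E N \<longleftrightarrow>
     (\<forall>x\<in>E. 0 \<le> N x \<and> (N x = 0 \<longleftrightarrow> x = 0)) \<and>
     (\<forall>x\<in>E. \<forall>c. N (c *\<^sub>R x) = \<bar>c\<bar> * N x) \<and>
     (\<forall>x\<in>E. \<forall>y\<in>E. N (x + y) \<le> N x + N y)"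

definition dual_norm :: "'v::real_inner set \<Rightarrow> ('v \<Rightarrow> real) \<Rightarrow> 'v \<Rightarrow> real" where
  "dual_norm E N y = (SUP x\<in>{x \<in> E. N x \<le> 1}. y \<bullet> x)"

definition diam :: "('v::real_inner \<Rightarrow> real) \<Rightarrow> 'v set \<Rightarrow> real" where
  "diam N X = (SUP (x, y)\<in>X \<times> X. N (x - y))"

definition is_grad :: "'v::real_inner set \<Rightarrow> ('v \<Rightarrow> real) \<Rightarrow> 'v \<Rightarrow> 'v \<Rightarrow> bool" where
  "is_grad E h x D \<longleftrightarrow> D \<in> E \<and> (h has_derivative (\<lambda>v. D \<bullet> v)) (at x within E)"

definition grad :: "'v::real_inner set \<Rightarrow> ('v \<Rightarrow> real) \<Rightarrow> 'v \<Rightarrow> 'v" where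
  "grad E h x = (SOME D. is_grad E h x D)"

definition smooth_on ::
  "'v::real_inner set \<Rightarrow> ('v \<Rightarrow> real) \<Rightarrow> 'v set \<Rightarrow> real \<Rightarrow> ('v \<Rightarrow> real) \<Rightarrow> bool" where
  "smooth_on E N X l h \<longleftrightarrow>
     (\<forall>x\<in>X. \<exists>D. is_grad E h x D) \<and>
     (\<forall>x\<in>X. \<forall>y\<in>X. dual_norm E N (grad E h x - grad E h y) \<le> l * N (x - y))"

definition strongly_convex_on ::
  "('v::real_inner \<Rightarrow> real) \<Rightarrow> 'v set \<Rightarrow> real \<Rightarrow> ('v \<Rightarrow> real) \<Rightarrow> bool" where
  "strongly_convex_on N X m h \<longleftrightarrow>
     (\<forall>x\<in>X. \<forall>y\<in>X. \<forall>t\<in>{0..1}.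
        h ((1 - t) *\<^sub>R x + t *\<^sub>R y)
          \<le> (1 - t) * h x + t * h y - m / 2 * t * (1 - t) * (N (x - y))\<^sup>2)"

section \<open>Extended-real-valued functions on \<open>E\<close>\<close>

definition edom :: "'v::real_inner set \<Rightarrow> ('v \<Rightarrow> ereal) \<Rightarrow> 'v set" where
  "edom E h = {x \<in> E. h x < \<infinity>}"

definition epigraph :: "'v::real_inner set \<Rightarrow> ('v \<Rightarrow> ereal) \<Rightarrow> ('v \<times> real) set" where
  "epigraph E h = {(x, t). x \<in> E \<and> h x \<le> ereal t}"

definition convex_closed_proper :: "'v::real_inner set \<Rightarrow> ('v \<Rightarrow> ereal) \<Rightarrow> bool" where
  "convex_closed_proper E h \<longleftrightarrow>
     convex (epigraph E h) \<and> closed (epigraph E h) \<and>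
     (\<forall>x\<in>E. h x \<noteq> -\<infinity>) \<and> edom E h \<noteq> {}"

definition int_edom :: "'v::real_inner set \<Rightarrow> ('v \<Rightarrow> ereal) \<Rightarrow> 'v set" where
  "int_edom E h = (top_of_set E) interior_of (edom E h)"

definition egrad :: "'v::real_inner set \<Rightarrow> ('v \<Rightarrow> ereal) \<Rightarrow> 'v \<Rightarrow> 'v" where
  "egrad E h x = grad E (\<lambda>y. real_of_ereal (h y)) x"

definition essentially_smooth ::
  "'v::real_inner set \<Rightarrow> ('v \<Rightarrow> real) \<Rightarrow> ('v \<Rightarrow> ereal) \<Rightarrow> bool" where
  "essentially_smooth E N h \<longleftrightarrow>
     int_edom E h \<noteq> {} \<and>
     (\<forall>x\<in>int_edom E h. \<exists>D. is_grad E (\<lambda>y. real_of_ereal (h y)) x D) \<and>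
     (\<forall>s b. (\<forall>k. s k \<in> int_edom E h) \<and> b \<in> (top_of_set E) frontier_of (int_edom E h) \<and> s \<longlonglongrightarrow> b
        \<longrightarrow> filterlim (\<lambda>k. dual_norm E N (egrad E h (s k))) at_top sequentially)"

definition dgf ::
  "'v::real_inner set \<Rightarrow> ('v \<Rightarrow> real) \<Rightarrow> 'v set \<Rightarrow> ('v \<Rightarrow> ereal) \<Rightarrow> ('v \<Rightarrow> ereal) \<Rightarrow> bool" where
  "dgf E N X r \<omega> \<longleftrightarrow>
     convex_closed_proper E \<omega> \<and> essentially_smooth E N \<omega> \<and>
     X \<subseteq> edom E \<omega> \<and> continuous_on X \<omega> \<and>
     strongly_convex_on N X 1 (\<lambda>x. real_of_ereal (\<omega> x)) \<and>
     (\<forall>a>0. \<forall>v\<in>E. \<exists>x\<in>X \<inter> int_edom E \<omega>. \<forall>y\<in>X. y \<noteq> x \<longrightarrow>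
        real_of_ereal (r x) + v \<bullet> x + real_of_ereal (\<omega> x) / a
          < real_of_ereal (r y) + v \<bullet> y + real_of_ereal (\<omega> y) / a)"

definition bregman_max :: "'v::real_inner set \<Rightarrow> 'v set \<Rightarrow> ('v \<Rightarrow> ereal) \<Rightarrow> 'v \<Rightarrow> real" where
  "bregman_max E U \<pi> u0 =
     (SUP u\<in>U. real_of_ereal (\<pi> u) - real_of_ereal (\<pi> u0) - egrad E \<pi> u0 \<bullet> (u - u0))"

section \<open>The constrained problem\<close>

text \<open>
  Minimize \<open>fo + ro\<close> over \<open>Xs \<subseteq> Es\<close> subject to \<open>gc i \<le> 0\<close> for \<open>i \<in> {1..nc}\<close>. The norm on \<open>Es\<close> is
  \<open>nrm\<close>, the distance generating function of \<open>ro\<close> is \<open>dg\<close>; \<open>mu\<close> and \<open>Lf\<close> are the strong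
  convexity and smoothness constants of \<open>fo\<close>, and \<open>al i\<close> is the smoothness constant of \<open>gc i\<close>.
\<close>

record 'v problem =
  Es :: "'v set"
  nrm :: "'v \<Rightarrow> real"
  Xs :: "'v set"
  fo :: "'v \<Rightarrow> real"
  ro :: "'v \<Rightarrow> ereal"
  dg :: "'v \<Rightarrow> ereal"
  nc :: nat
  gc :: "nat \<Rightarrow> 'v \<Rightarrow> real"
  mu :: real
  Lf :: real
  al :: "nat \<Rightarrow> real"

definition X_int :: "'v::real_inner problem \<Rightarrow> 'v set" where
  "X_int P = Xs P \<inter> int_edom (Es P) (dg P)"

definition valid_problem :: "'v::real_inner problem \<Rightarrow> bool" where
  "valid_problem P \<longleftrightarrow>
     findim_subspace (Es P) \<and> norm_on (Es P) (nrm P) \<and>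
     Xs P \<subseteq> Es P \<and> Xs P \<noteq> {} \<and> convex (Xs P) \<and> compact (Xs P) \<and>
     0 < mu P \<and> mu P \<le> Lf P \<and>
     strongly_convex_on (nrm P) (Xs P) (mu P) (fo P) \<and>
     smooth_on (Es P) (nrm P) (Xs P) (Lf P) (fo P) \<and>
     convex_closed_proper (Es P) (ro P) \<and> Xs P \<subseteq> edom (Es P) (ro P) \<and>
     dgf (Es P) (nrm P) (Xs P) (ro P) (dg P) \<and>
     1 \<le> nc P \<and>
     (\<forall>i\<in>{1..nc P}. 0 \<le> al P i \<and> convex_on (Xs P) (gc P i) \<and>
        smooth_on (Es P) (nrm P) (Xs P) (al P i) (gc P i)) \<and>
     (\<exists>x\<in>X_int P. \<forall>i\<in>{1..nc P}. gc P i x < 0)"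

definition obj :: "'v::real_inner problem \<Rightarrow> 'v \<Rightarrow> real" where
  "obj P x = fo P x + real_of_ereal (ro P x)"

definition optimal :: "'v::real_inner problem \<Rightarrow> 'v \<Rightarrow> bool" where
  "optimal P xs \<longleftrightarrow>
     xs \<in> Xs P \<and> (\<forall>i\<in>{1..nc P}. gc P i xs \<le> 0) \<and>
     (\<forall>x\<in>Xs P. (\<forall>i\<in>{1..nc P}. gc P i x \<le> 0) \<longrightarrow> obj P xs \<le> obj P x)"

definition pos :: "real \<Rightarrow> real" where
  "pos a = max a 0"

definition eps_solution :: "'v::real_inner problem \<Rightarrow> 'v \<Rightarrow> real \<Rightarrow> 'v \<Rightarrow> bool" where
  "eps_solution P xs \<epsilon> x \<longleftrightarrow>
     x \<in> Xs P \<and> obj P x - obj P xs \<le> \<epsilon> \<and> (\<forall>i\<in>{1..nc P}. pos (gc P i x) \<le> \<epsilon>)"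

text \<open>\<open>\<real>\<^sup>n\<^sub>+\<close>, vectors being extended by zero outside \<open>{1..nc P}\<close>.\<close>

definition multipliers :: "'v::real_inner problem \<Rightarrow> (nat \<Rightarrow> real) set" where
  "multipliers P = {l. (\<forall>i\<in>{1..nc P}. 0 \<le> l i) \<and> (\<forall>i. i \<notin> {1..nc P} \<longrightarrow> l i = 0)}"

definition lagr :: "'v::real_inner problem \<Rightarrow> 'v \<Rightarrow> (nat \<Rightarrow> real) \<Rightarrow> real" where
  "lagr P x l = fo P x + real_of_ereal (ro P x) + (\<Sum>i=1..nc P. l i * gc P i x)"

definition saddle_point :: "'v::real_inner problem \<Rightarrow> 'v \<Rightarrow> (nat \<Rightarrow> real) \<Rightarrow> bool" where
  "saddle_point P xs ls \<longleftrightarrow>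
     xs \<in> Xs P \<and> ls \<in> multipliers P \<and>
     (\<forall>x\<in>Xs P. \<forall>l\<in>multipliers P. lagr P xs l \<le> lagr P xs ls \<and> lagr P xs ls \<le> lagr P x ls)"

definition dual_fun :: "'v::real_inner problem \<Rightarrow> (nat \<Rightarrow> real) \<Rightarrow> real" where
  "dual_fun P l = (INF x\<in>Xs P. lagr P x l)"

definition Delta :: "'v::real_inner problem \<Rightarrow> real \<Rightarrow> 'v \<Rightarrow> (nat \<Rightarrow> real) \<Rightarrow> real" where
  "Delta P \<rho> x l =
     (SUP l'\<in>multipliers P. lagr P x l' - \<rho> / 2 * (\<Sum>i=1..nc P. (l' i)\<^sup>2)) - dual_fun P l"

definition Mi :: "'v::real_inner problem \<Rightarrow> nat \<Rightarrow> real" where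
  "Mi P i = al P i * diam (nrm P) (Xs P)
          + (INF x\<in>Xs P. dual_norm (Es P) (nrm P) (grad (Es P) (gc P i) x))"

definition Msum :: "'v::real_inner problem \<Rightarrow> real" where
  "Msum P = (\<Sum>i=1..nc P. Mi P i)"

definition LD :: "'v::real_inner problem \<Rightarrow> real" where
  "LD P = (Msum P)\<^sup>2 / mu P"

definition alpha :: "'v::real_inner problem \<Rightarrow> real" where
  "alpha P = (\<Sum>i=1..nc P. al P i)"

definition Lxx :: "'v::real_inner problem \<Rightarrow> (nat \<Rightarrow> real) \<Rightarrow> real" where
  "Lxx P l = (\<Sum>i=1..nc P. l i * al P i)"

section \<open>The primal oracle and the sub-problem solver\<close>

datatype 'v query = Qf 'v | Qg 'v "nat \<Rightarrow> real" nat

fun primal_oracle :: "'v::real_inner problem \<Rightarrow> 'v query \<Rightarrow> 'v" where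
  "primal_oracle P (Qf x) = grad (Es P) (fo P) x"
| "primal_oracle P (Qg x l i) = l i *\<^sub>R grad (Es P) (gc P i) x"

text \<open>
  A deterministic solver for the sub-problems
  \<open>min\<^bsub>x \<in> X\<^esub> (f x + (\<Sum>i. l i * g i x)) + r x\<close> with smooth part
  \<open>f + (\<Sum>i. l i * g i)\<close>. It is described by the point at which the next iteration
  evaluates the gradient of the smooth part and by the current iterate; both depend on the
  sub-problem \<open>l\<close> and on the oracle calls made so far, together with their answers. The
  remaining data (\<open>X\<close>, \<open>r\<close>, \<open>\<omega>\<close>, \<open>L\<close>, \<open>\<mu>\<close>, the starting point) do not vary between sub-problems.
\<close>

record 'v solver =
  query_point :: "(nat \<Rightarrow> real) \<Rightarrow> ('v query \<times> 'v) list \<Rightarrow> 'v"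
  iterate :: "(nat \<Rightarrow> real) \<Rightarrow> ('v query \<times> 'v) list \<Rightarrow> 'v"

definition grad_queries :: "'v::real_inner problem \<Rightarrow> (nat \<Rightarrow> real) \<Rightarrow> 'v \<Rightarrow> 'v query list" where
  "grad_queries P l y = Qf y # map (Qg y l) [1..<nc P + 1]"

primrec history ::
  "'v::real_inner problem \<Rightarrow> 'v solver \<Rightarrow> (nat \<Rightarrow> real) \<Rightarrow> nat \<Rightarrow> ('v query \<times> 'v) list" where
  "history P A l 0 = []"
| "history P A l (Suc t) =
     history P A l t @
     map (\<lambda>q. (q, primal_oracle P q)) (grad_queries P l (query_point A l (history P A l t)))"

definition solver_iterate ::
  "'v::real_inner problem \<Rightarrow> 'v solver \<Rightarrow> (nat \<Rightarrow> real) \<Rightarrow> nat \<Rightarrow> 'v" where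
  "solver_iterate P A l t = iterate A l (history P A l t)"

definition apg_bound :: "real \<Rightarrow> real \<Rightarrow> real \<Rightarrow> nat \<Rightarrow> real" where
  "apg_bound L' \<mu>' D t = L' / 4 * (1 + 1 / sqrt (2 * (L' / \<mu>'))) powr (- 2 * (real t - 1)) * D"

text \<open>
  The accelerated proximal gradient method enters through its convergence guarantee for the
  instances \<open>\<phi>\<^sub>1 = f + (\<Sum>i. l i * g i)\<close>, \<open>\<phi>\<^sub>2 = r\<close>, \<open>U = X\<close>, started at \<open>u0\<close>.
\<close>

definition apg_guarantee :: "'v::real_inner problem \<Rightarrow> 'v solver \<Rightarrow> 'v \<Rightarrow> bool" where
  "apg_guarantee P A u0 \<longleftrightarrow>
     (\<forall>l\<in>multipliers P. \<forall>t\<ge>1. solver_iterate P A l t \<in> Xs P \<and>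
        lagr P (solver_iterate P A l t) l - dual_fun P l
          \<le> apg_bound (Lf P + Lxx P l) (mu P) (bregman_max (Es P) (Xs P) (dg P) u0) t)"

text \<open>The number of iterations after which the guarantee yields accuracy \<open>e\<close>.\<close>

definition apg_iters :: "'v::real_inner problem \<Rightarrow> 'v \<Rightarrow> (nat \<Rightarrow> real) \<Rightarrow> real \<Rightarrow> nat" where
  "apg_iters P u0 l e =
     (LEAST t. 1 \<le> t \<and>
        apg_bound (Lf P + Lxx P l) (mu P) (bregman_max (Es P) (Xs P) (dg P) u0) t \<le> e)"

section \<open>The deterministic IPDS algorithm\<close>

definition tau :: "nat \<Rightarrow> real" where
  "tau k = (real k + 1) / (real k + 3)"

definition gam :: "real \<Rightarrow> nat \<Rightarrow> real" where
  "gam \<epsilon> k = \<epsilon> / (4 * (real k + 3))"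

primrec rho :: "'v::real_inner problem \<Rightarrow> nat \<Rightarrow> real" where
  "rho P 0 = 8 * LD P"
| "rho P (Suc k) = tau k * rho P k"

definition lam_tilde :: "'v::real_inner problem \<Rightarrow> real \<Rightarrow> 'v \<Rightarrow> nat \<Rightarrow> real" where
  "lam_tilde P \<rho> x = (\<lambda>i. if i \<in> {1..nc P} then pos (gc P i x) / \<rho> else 0)"

definition lam_hat ::
  "'v::real_inner problem \<Rightarrow> nat \<Rightarrow> 'v \<times> (nat \<Rightarrow> real) \<Rightarrow> nat \<Rightarrow> real" where
  "lam_hat P k = (\<lambda>(x, l) i. tau k * l i + (1 - tau k) * lam_tilde P (rho P k) x i)"

primrec ipds ::
  "'v::real_inner problem \<Rightarrow> 'v solver \<Rightarrow> 'v \<Rightarrow> real \<Rightarrow> 'v \<Rightarrow> (nat \<Rightarrow> real) \<Rightarrow> nat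
     \<Rightarrow> 'v \<times> (nat \<Rightarrow> real)" where
  "ipds P A u0 \<epsilon> x0 l0 0 = (x0, l0)"
| "ipds P A u0 \<epsilon> x0 l0 (Suc k) =
     (let z = ipds P A u0 \<epsilon> x0 l0 k;
          lh = lam_hat P k z;
          xt = solver_iterate P A lh (apg_iters P u0 lh (gam \<epsilon> k));
          x' = tau k *\<^sub>R fst z + (1 - tau k) *\<^sub>R xt;
          l' = (\<lambda>i. tau k * snd z i + (1 - tau k) * lam_tilde P (rho P (Suc k)) x' i)
      in (x', l'))"

text \<open>The primal oracle calls made in order to compute the \<open>K\<close>-th primal iterate.\<close>

definition ipds_calls ::
  "'v::real_inner problem \<Rightarrow> 'v solver \<Rightarrow> 'v \<Rightarrow> real \<Rightarrow> 'v \<Rightarrow> (nat \<Rightarrow> real) \<Rightarrow> nat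
     \<Rightarrow> 'v query list" where
  "ipds_calls P A u0 \<epsilon> x0 l0 K =
     concat (map (\<lambda>k. let lh = lam_hat P k (ipds P A u0 \<epsilon> x0 l0 k)
                      in map fst (history P A lh (apg_iters P u0 lh (gam \<epsilon> k)))) [0..<K])"

text \<open>The value is \<open>\<infinity>\<close> if no iterate is \<open>\<epsilon>\<close>-optimal and \<open>\<epsilon>\<close>-feasible.\<close>

definition C_det ::
  "'v::real_inner problem \<Rightarrow> 'v solver \<Rightarrow> 'v \<Rightarrow> 'v \<Rightarrow> 'v \<Rightarrow> (nat \<Rightarrow> real) \<Rightarrow> real \<Rightarrow> enat" where
  "C_det P A u0 xs x0 l0 \<epsilon> =
     (INF K\<in>{K. eps_solution P xs \<epsilon> (fst (ipds P A u0 \<epsilon> x0 l0 K))}.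
        enat (length (ipds_calls P A u0 \<epsilon> x0 l0 K)))"

end

theory Submission
  imports Defs
begin

text \<open>
  The proof follows the excessive gap technique. Write \<open>\<psi>\<^sub>\<rho>(x)\<close> for the smoothed primal function
  \<open>obj x + \<Sum>\<^sub>i [g\<^sub>i(x)]\<^sub>+\<^sup>2 / (2\<rho>)\<close> and \<open>\<psi>\<^sup>D\<close> for the dual function; the gap of the \<open>k\<close>-th iterate is
  \<open>\<psi>\<^sub>\<rho>(x) - \<psi>\<^sup>D(l)\<close> with \<open>\<rho> = \<rho>\<^sub>k\<close>.

  A small gap together with a small \<open>\<rho>\<close> solves the problem: the gap bounds the error of the
  objective by weak duality, and by the saddle point property it bounds each squared violation
  \<open>[g\<^sub>j(x)]\<^sub>+\<^sup>2\<close> by \<open>4 \<rho> (gap + \<rho> \<parallel>l\<^sup>*\<parallel>\<^sup>2)\<close> (\<open>violation_le_gap\<close>).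

  One iteration maps the gap to at most \<open>\<tau>\<^sub>k * gap + 2 \<gamma>\<^sub>k\<close> (\<open>excessive_gap_step\<close>). The dual function
  has curvature at most of order \<open>L\<^sub>D = M\<^sup>2/\<mu>\<close>, because \<open>f\<close> is strongly convex and \<open>M\<^sub>i\<close> is a Lipschitz
  constant of \<open>g\<^sub>i\<close> (\<open>dual_fun_lower_bound\<close>); the resulting loss is of second order in the change of
  the penalty multipliers and is paid for by the strong concavity, with modulus \<open>\<rho>\<close>, of the problem
  defining \<open>\<psi>\<^sub>\<rho>\<close>. As \<open>\<rho>\<^sub>k = 16 L\<^sub>D / ((k+1) (k+2))\<close>, the gap after \<open>K\<close> iterations is
  \<open>O(L\<^sub>D / K\<^sup>2) + \<epsilon>/4\<close>, and a \<open>K\<close> of order \<open>sqrt (L\<^sub>D / \<epsilon>) = M / sqrt (\<mu> \<epsilon>)\<close> suffices.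

  For the inner iterations, the bound on the violations shows that all multipliers
  \<open>[g\<^sub>i(x)]\<^sub>+ / \<rho>\<^sub>k\<close> with \<open>k \<le> K\<close> are bounded by a constant (\<open>lam_tilde_le\<close>). So every sub-problem has
  condition number \<open>O((L + \<alpha>) / \<mu>)\<close> and the accelerated method needs
  \<open>O(sqrt ((L + \<alpha>) / \<mu>) ln ((L + \<alpha>) / \<epsilon>))\<close> iterations of \<open>n + 1\<close> oracle calls each. Everything else
  inside the logarithm is absorbed by taking \<open>\<epsilon>\<close> small.
\<close>

section \<open>Norms on a finite-dimensional subspace\<close>

text \<open>
  Closed balls of \<open>'v\<close> need not be compact, so compactness inside a finite-dimensional subspace is
  built up as a finite Minkowski sum of segments.
\<close>

lemma compact_coefficient_box:
  fixes C :: "'v::real_inner set"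
  assumes "finite C"
  shows "compact {x. \<exists>c. (\<forall>b\<in>C. \<bar>c b\<bar> \<le> R) \<and> x = (\<Sum>b\<in>C. c b *\<^sub>R b)}"
  using assms
proof (induction C)
  case empty
  have "{x::'v. \<exists>c. (\<forall>b\<in>{}. \<bar>c b\<bar> \<le> R) \<and> x = (\<Sum>b\<in>{}. c b *\<^sub>R b)} = {0}" by auto
  then show ?case by simp
next
  case (insert a C)
  let ?Q = "\<lambda>C. {x. \<exists>c. (\<forall>b\<in>C. \<bar>c b\<bar> \<le> R) \<and> x = (\<Sum>b\<in>C. c b *\<^sub>R b)}"
  let ?I = "(\<lambda>t. t *\<^sub>R a) ` {-R..R}"
  have eq: "?Q (insert a C) = {x + y | x y. x \<in> ?I \<and> y \<in> ?Q C}"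
  proof (intro set_eqI iffI)
    fix x assume "x \<in> ?Q (insert a C)"
    then obtain c where c: "\<forall>b\<in>insert a C. \<bar>c b\<bar> \<le> R" "x = (\<Sum>b\<in>insert a C. c b *\<^sub>R b)" by auto
    have "x = c a *\<^sub>R a + (\<Sum>b\<in>C. c b *\<^sub>R b)" using c insert by simp
    moreover have "c a *\<^sub>R a \<in> ?I" using c(1) by (intro imageI) (auto simp: abs_le_iff)
    moreover have "(\<Sum>b\<in>C. c b *\<^sub>R b) \<in> ?Q C" using c(1) by auto
    ultimately show "x \<in> {x + y | x y. x \<in> ?I \<and> y \<in> ?Q C}" by blast
  next
    fix x assume "x \<in> {x + y | x y. x \<in> ?I \<and> y \<in> ?Q C}"
    then obtain t c where t: "t \<in> {-R..R}" and c: "\<forall>b\<in>C. \<bar>c b\<bar> \<le> R"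
      and x: "x = t *\<^sub>R a + (\<Sum>b\<in>C. c b *\<^sub>R b)" by auto
    have "(\<Sum>b\<in>insert a C. (c(a := t)) b *\<^sub>R b) = t *\<^sub>R a + (\<Sum>b\<in>C. (c(a := t)) b *\<^sub>R b)"
      using insert by simp
    also have "(\<Sum>b\<in>C. (c(a := t)) b *\<^sub>R b) = (\<Sum>b\<in>C. c b *\<^sub>R b)"
      by (rule sum.cong) (use insert in auto)
    finally have "x = (\<Sum>b\<in>insert a C. (c(a := t)) b *\<^sub>R b)" using x by simp
    moreover have "\<forall>b\<in>insert a C. \<bar>(c(a := t)) b\<bar> \<le> R" using t c by auto
    ultimately show "x \<in> ?Q (insert a C)" by blast
  qed
  have "compact ?I" by (intro compact_continuous_image continuous_intros) auto
  then show ?case unfolding eq by (rule compact_sums) (rule insert.IH)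
qed

lemma subspace_findim: "findim_subspace E \<Longrightarrow> subspace E"
  by (auto simp: findim_subspace_def)

text \<open>
  With respect to an orthogonal basis, each coordinate is controlled by the Euclidean norm
  (Cauchy--Schwarz). This traps the unit sphere in a compact box, and it makes every norm
  continuous.
\<close>

lemma findim_bounded_coordinates:
  assumes "findim_subspace E"
  obtains C where "finite C" "span C = E"
    "\<And>x. x \<in> E \<Longrightarrow> \<exists>c. x = (\<Sum>b\<in>C. c b *\<^sub>R b) \<and> (\<forall>b\<in>C. \<bar>c b\<bar> \<le> norm x / norm b)"
proof -
  obtain B where B: "finite B" "E = span B" using assms by (auto simp: findim_subspace_def)
  obtain C0 where C0: "finite C0" "span C0 = span B" "pairwise orthogonal C0"
    using basis_orthogonal[OF B(1)] by blast
  define C where "C = C0 - {0}"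
  have C: "finite C" "span C = E" "pairwise orthogonal C" "0 \<notin> C"
    using C0 B by (auto simp: C_def span_delete_0 pairwise_def)
  have coord: "\<exists>c. x = (\<Sum>b\<in>C. c b *\<^sub>R b) \<and> (\<forall>b\<in>C. \<bar>c b\<bar> \<le> norm x / norm b)" if x: "x \<in> E" for x
  proof -
    obtain c where c: "x = (\<Sum>b\<in>C. c b *\<^sub>R b)"
      using x C(2) span_finite[OF C(1)] by auto
    have "\<bar>c b\<bar> \<le> norm x / norm b" if b: "b \<in> C" for b
    proof -
      have "x \<bullet> b = (\<Sum>b'\<in>C. c b' * (b' \<bullet> b))" unfolding c by (simp add: inner_sum_left)
      also have "\<dots> = (\<Sum>b'\<in>C. if b' = b then c b * (b \<bullet> b) else 0)"
        using C(3) b by (intro sum.cong) (auto simp: pairwise_def orthogonal_def)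
      also have "\<dots> = c b * (norm b)\<^sup>2" using b C(1) by (simp add: dot_square_norm)
      finally have "\<bar>c b\<bar> * (norm b)\<^sup>2 \<le> norm x * norm b"
        using Cauchy_Schwarz_ineq2[of x b] by (simp add: abs_mult)
      moreover have "norm b > 0" using b C(4) by auto
      ultimately show ?thesis by (simp add: field_simps power2_eq_square)
    qed
    then show ?thesis using c by blast
  qed
  show ?thesis by (rule that[OF C(1,2) coord])
qed

lemma compact_unit_sphere_findim:
  fixes E :: "'v::real_inner set"
  assumes "findim_subspace E"
  shows "compact {x \<in> E. norm x = 1}"
proof -
  obtain C where C: "finite C" "span C = E"
    and coord: "\<And>x. x \<in> E \<Longrightarrow>
      \<exists>c. x = (\<Sum>b\<in>C. c b *\<^sub>R b) \<and> (\<forall>b\<in>C. \<bar>c b\<bar> \<le> norm x / norm b)"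
    using findim_bounded_coordinates[OF assms] by blast
  define R where "R = (\<Sum>b\<in>C. 1 / norm b)"
  have R: "1 / norm b \<le> R" if "b \<in> C" for b
    unfolding R_def using member_le_sum[of b C "\<lambda>b. 1 / norm b"] C(1) that by simp
  let ?Q = "{x. \<exists>c. (\<forall>b\<in>C. \<bar>c b\<bar> \<le> R) \<and> x = (\<Sum>b\<in>C. c b *\<^sub>R b)}"
  have "?Q \<subseteq> E" unfolding C(2)[symmetric] by clarify (intro span_sum span_scale span_base)
  moreover have "{x \<in> E. norm x = 1} \<subseteq> ?Q"
  proof clarify
    fix x assume x: "x \<in> E" "norm x = 1"
    show "\<exists>c. (\<forall>b\<in>C. \<bar>c b\<bar> \<le> R) \<and> x = (\<Sum>b\<in>C. c b *\<^sub>R b)"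
      using coord[OF x(1)] R x(2) by (metis order_trans)
  qed
  ultimately have "{x \<in> E. norm x = 1} = ?Q \<inter> {x. norm x = 1}" by auto
  moreover have "closed {x::'v. norm x = 1}" by (intro closed_Collect_eq continuous_intros)
  then have "compact (?Q \<inter> {x. norm x = 1})"
    by (intro compact_Int_closed compact_coefficient_box C(1))
  ultimately show ?thesis by (simp only:)
qed

lemma norm_on_le_norm:
  assumes E: "findim_subspace E" and N: "norm_on E N"
  obtains c where "\<And>x. x \<in> E \<Longrightarrow> N x \<le> c * norm x"
proof -
  obtain C where C: "finite C" "span C = E"
    and coord: "\<And>x. x \<in> E \<Longrightarrow>
      \<exists>c. x = (\<Sum>b\<in>C. c b *\<^sub>R b) \<and> (\<forall>b\<in>C. \<bar>c b\<bar> \<le> norm x / norm b)"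
    using findim_bounded_coordinates[OF E] by blast
  have sub: "subspace E" by (rule subspace_findim[OF E])
  have N_sum: "N (\<Sum>b\<in>D. c b *\<^sub>R b) \<le> (\<Sum>b\<in>D. \<bar>c b\<bar> * N b)" if "finite D" "D \<subseteq> C" for D c
    using that
  proof (induction D)
    case empty
    have "N 0 = 0" using N sub by (auto simp: norm_on_def subspace_0)
    then show ?case by simp
  next
    case (insert a D)
    have a: "a \<in> E" using insert C(2) span_base by blast
    have D: "(\<Sum>b\<in>D. c b *\<^sub>R b) \<in> E"
      unfolding C(2)[symmetric] using insert by (intro span_sum span_scale span_base) auto
    have "N (c a *\<^sub>R a + (\<Sum>b\<in>D. c b *\<^sub>R b)) \<le> N (c a *\<^sub>R a) + N (\<Sum>b\<in>D. c b *\<^sub>R b)"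
      using N subspace_scale[OF sub a, of "c a"] D by (simp add: norm_on_def)
    also have "N (c a *\<^sub>R a) = \<bar>c a\<bar> * N a" using N a by (auto simp: norm_on_def)
    finally show ?case using insert by simp
  qed
  show ?thesis
  proof
    fix x assume x: "x \<in> E"
    obtain c where c: "x = (\<Sum>b\<in>C. c b *\<^sub>R b)" "\<forall>b\<in>C. \<bar>c b\<bar> \<le> norm x / norm b"
      using coord[OF x] by blast
    have "N x \<le> (\<Sum>b\<in>C. \<bar>c b\<bar> * N b)" unfolding c(1) by (rule N_sum) (use C in auto)
    also have "\<dots> \<le> (\<Sum>b\<in>C. norm x / norm b * N b)"
      using c(2) N C(2) span_base by (intro sum_mono mult_right_mono) (auto simp: norm_on_def)
    also have "\<dots> = (\<Sum>b\<in>C. N b / norm b) * norm x"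
      by (simp add: sum_distrib_left sum_distrib_right mult.commute)
    finally show "N x \<le> (\<Sum>b\<in>C. N b / norm b) * norm x" .
  qed
qed

lemma norm_on_diff_commute:
  assumes "subspace E" "norm_on E N" "x \<in> E" "y \<in> E"
  shows "N (x - y) = N (y - x)"
proof -
  have d: "x - y \<in> E" using assms by (simp add: subspace_diff)
  have "N ((-1) *\<^sub>R (x - y)) = \<bar>-1\<bar> * N (x - y)" using assms(2) d unfolding norm_on_def by blast
  then show ?thesis by simp
qed

lemma norm_on_reverse_triangle:
  assumes "subspace E" "norm_on E N" "x \<in> E" "y \<in> E"
  shows "\<bar>N x - N y\<bar> \<le> N (x - y)"
proof -
  have d: "x - y \<in> E" "y - x \<in> E" using assms by (auto simp: subspace_diff)
  have tri: "N (a + b) \<le> N a + N b" if "a \<in> E" "b \<in> E" for a b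
    using assms(2) that unfolding norm_on_def by blast
  have "N x \<le> N (x - y) + N y" using tri[of "x - y" y] d assms by simp
  moreover have "N y \<le> N (y - x) + N x" using tri[of "y - x" x] d assms by simp
  ultimately show ?thesis using norm_on_diff_commute[OF assms] by linarith
qed

lemma continuous_on_norm_on:
  assumes E: "findim_subspace E" and N: "norm_on E N"
  shows "continuous_on E N"
proof -
  obtain c where c: "\<And>x. x \<in> E \<Longrightarrow> N x \<le> c * norm x" using norm_on_le_norm[OF E N] by blast
  have sub: "subspace E" by (rule subspace_findim[OF E])
  have "\<bar>c\<bar>-lipschitz_on E N"
  proof (rule lipschitz_onI)
    fix x y assume xy: "x \<in> E" "y \<in> E"
    have "\<bar>N x - N y\<bar> \<le> N (x - y)" by (rule norm_on_reverse_triangle[OF sub N xy])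
    also have "\<dots> \<le> c * norm (x - y)" using c xy sub by (simp add: subspace_diff)
    also have "\<dots> \<le> \<bar>c\<bar> * norm (x - y)" by (simp add: mult_right_mono)
    finally show "dist (N x) (N y) \<le> \<bar>c\<bar> * dist x y" by (simp add: dist_norm)
  qed simp
  then show ?thesis by (rule lipschitz_on_continuous_on)
qed

text \<open>
  A norm is continuous, hence attains a positive minimum on the compact unit sphere. This half of
  the equivalence of norms bounds the unit ball of \<open>N\<close>, so that the supremum defining the dual norm
  is finite.
\<close>

lemma norm_le_norm_on:
  assumes E: "findim_subspace E" and N: "norm_on E N"
  obtains c where "c > 0" "\<And>x. x \<in> E \<Longrightarrow> norm x \<le> c * N x"
proof (cases "\<exists>x\<in>E. norm x = 1")
  case True
  let ?S = "{x \<in> E. norm x = 1}"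
  have "\<exists>s\<in>?S. \<forall>x\<in>?S. N s \<le> N x"
    by (rule continuous_attains_inf[OF compact_unit_sphere_findim[OF E]])
      (use True in \<open>auto intro: continuous_on_subset[OF continuous_on_norm_on[OF E N]]\<close>)
  then obtain s where s: "s \<in> E" "norm s = 1" "\<And>x. x \<in> E \<Longrightarrow> norm x = 1 \<Longrightarrow> N s \<le> N x" by auto
  have pos: "N s > 0" using N s(1,2) unfolding norm_on_def by (metis less_eq_real_def norm_zero zero_neq_one)
  show ?thesis
  proof (rule that[of "1 / N s"])
    fix x assume x: "x \<in> E"
    show "norm x \<le> 1 / N s * N x"
    proof (cases "x = 0")
      case False
      have "(1 / norm x) *\<^sub>R x \<in> E" using subspace_findim[OF E] x by (simp add: subspace_scale)
      then have "N s \<le> N ((1 / norm x) *\<^sub>R x)" using s(3) False by simp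
      also have "\<dots> = 1 / norm x * N x" using N x by (auto simp: norm_on_def)
      finally show ?thesis using False pos by (simp add: field_simps)
    qed (use N x pos in \<open>auto simp: norm_on_def\<close>)
  qed (use pos in simp)
next
  case False
  show ?thesis
  proof (rule that[of 1])
    fix x assume x: "x \<in> E"
    have "x = 0"
    proof (rule ccontr)
      assume "x \<noteq> 0"
      moreover have "(1 / norm x) *\<^sub>R x \<in> E" using subspace_findim[OF E] x by (simp add: subspace_scale)
      ultimately show False using False by force
    qed
    then show "norm x \<le> 1 * N x" using N x by (auto simp: norm_on_def)
  qed simp
qed

locale findim_normed =
  fixes E :: "'v::real_inner set" and N :: "'v \<Rightarrow> real"
  assumes findim: "findim_subspace E" and norm_on: "norm_on E N"
begin

lemma subspace: "subspace E" by (rule subspace_findim[OF findim])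

lemma N_nonneg: "x \<in> E \<Longrightarrow> 0 \<le> N x"
  using norm_on by (simp add: norm_on_def)

lemma bdd_above_dual: "bdd_above ((\<lambda>x. y \<bullet> x) ` {x \<in> E. N x \<le> 1})"
proof -
  obtain c where c: "c > 0" "\<And>x. x \<in> E \<Longrightarrow> norm x \<le> c * N x"
    using norm_le_norm_on[OF findim norm_on] by blast
  show ?thesis
  proof (rule bdd_aboveI2)
    fix x assume x: "x \<in> {x \<in> E. N x \<le> 1}"
    have "y \<bullet> x \<le> norm y * norm x" using Cauchy_Schwarz_ineq2[of y x] by linarith
    also have "\<dots> \<le> norm y * (c * 1)"
      using c(2)[of x] c(1) x by (intro mult_left_mono) (auto intro: order_trans mult_left_mono)
    finally show "y \<bullet> x \<le> norm y * c" by simp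
  qed
qed

lemma inner_le_dual_norm_unit: "x \<in> E \<Longrightarrow> N x \<le> 1 \<Longrightarrow> y \<bullet> x \<le> dual_norm E N y"
  unfolding dual_norm_def by (rule cSUP_upper[OF _ bdd_above_dual]) simp

lemma zero_in_unit_ball: "0 \<in> {x \<in> E. N x \<le> 1}"
  using norm_on subspace_0[OF subspace] by (auto simp: norm_on_def)

lemma dual_norm_nonneg: "0 \<le> dual_norm E N y"
  using inner_le_dual_norm_unit[of 0 y] zero_in_unit_ball by simp

lemma inner_le_dual_norm:
  assumes x: "x \<in> E"
  shows "y \<bullet> x \<le> dual_norm E N y * N x"
proof (cases "x = 0")
  case True
  then have "N x = 0" using norm_on x unfolding norm_on_def by blast
  then show ?thesis using True by simp
next
  case False
  have pos: "N x > 0" using False N_nonneg[OF x] norm_on x by (auto simp: norm_on_def less_le)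
  have "y \<bullet> ((1 / N x) *\<^sub>R x) \<le> dual_norm E N y"
  proof (rule inner_le_dual_norm_unit)
    show "(1 / N x) *\<^sub>R x \<in> E" using x subspace by (simp add: subspace_scale)
    have "N ((1 / N x) *\<^sub>R x) = \<bar>1 / N x\<bar> * N x" using norm_on x unfolding norm_on_def by blast
    then show "N ((1 / N x) *\<^sub>R x) \<le> 1" using pos by simp
  qed
  then show ?thesis using pos by (simp add: field_simps)
qed

lemma dual_norm_triangle: "dual_norm E N (y + z) \<le> dual_norm E N y + dual_norm E N z"
proof -
  have "dual_norm E N (y + z) = (SUP x\<in>{x \<in> E. N x \<le> 1}. (y + z) \<bullet> x)" by (simp add: dual_norm_def)
  also have "\<dots> \<le> dual_norm E N y + dual_norm E N z"
  proof (rule cSUP_least)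
    show "{x \<in> E. N x \<le> 1} \<noteq> {}" using zero_in_unit_ball by blast
    fix x assume "x \<in> {x \<in> E. N x \<le> 1}"
    then show "(y + z) \<bullet> x \<le> dual_norm E N y + dual_norm E N z"
      using inner_le_dual_norm_unit[of x y] inner_le_dual_norm_unit[of x z] by (simp add: inner_add_left)
  qed
  finally show ?thesis .
qed

lemma N_le_diam:
  assumes X: "X \<subseteq> E" "compact X" and xy: "x \<in> X" "y \<in> X"
  shows "N (x - y) \<le> diam N X"
proof -
  have "continuous_on (X \<times> X) (\<lambda>z. N (fst z - snd z))"
    by (rule continuous_on_compose2[OF continuous_on_norm_on[OF findim norm_on]])
      (use X subspace in \<open>auto intro!: continuous_intros simp: subspace_diff subset_iff\<close>)
  then have "compact ((\<lambda>z. N (fst z - snd z)) ` (X \<times> X))"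
    by (rule compact_continuous_image) (use X in \<open>simp add: compact_Times\<close>)
  then have "bdd_above ((\<lambda>(x, y). N (x - y)) ` (X \<times> X))"
    by (simp add: compact_imp_bounded bounded_imp_bdd_above case_prod_unfold)
  then show ?thesis unfolding diam_def
    using xy cSUP_upper[of "(x, y)" "X \<times> X" "\<lambda>(x, y). N (x - y)"] by simp
qed

lemma is_grad_grad: "smooth_on E N X l h \<Longrightarrow> x \<in> X \<Longrightarrow> is_grad E h x (grad E h x)"
  unfolding smooth_on_def grad_def by (metis someI_ex)

lemma continuous_on_smooth_on:
  assumes "smooth_on E N X l h" "X \<subseteq> E"
  shows "continuous_on X h"
  unfolding continuous_on_eq_continuous_within
proof
  fix x assume "x \<in> X"
  then have "(h has_derivative (\<lambda>v. grad E h x \<bullet> v)) (at x within E)"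
    using is_grad_grad[OF assms(1)] by (simp add: is_grad_def)
  then have "(h has_derivative (\<lambda>v. grad E h x \<bullet> v)) (at x within X)"
    using assms(2) by (rule has_derivative_subset)
  then show "continuous (at x within X) h" by (rule has_derivative_continuous)
qed

text \<open>
  Compare the gradient at \<open>x\<close> with the gradient at an arbitrary \<open>y\<close>: smoothness moves the dual norm
  by at most \<open>l\<close> times the diameter. Taking the infimum over \<open>y\<close> produces the constants \<open>M\<^sub>i\<close>, which
  are therefore Lipschitz constants of the constraints.
\<close>

lemma dual_norm_grad_le:
  assumes sm: "smooth_on E N X l h" and l: "0 \<le> l" and X: "X \<subseteq> E" "compact X" and x: "x \<in> X"
  shows "dual_norm E N (grad E h x) \<le> l * diam N X + (INF y\<in>X. dual_norm E N (grad E h y))"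
proof -
  have "dual_norm E N (grad E h x) - l * diam N X \<le> (INF y\<in>X. dual_norm E N (grad E h y))"
  proof (rule cINF_greatest)
    show "X \<noteq> {}" using x by blast
    fix y assume y: "y \<in> X"
    have "dual_norm E N (grad E h x)
        \<le> dual_norm E N (grad E h x - grad E h y) + dual_norm E N (grad E h y)"
      using dual_norm_triangle[of "grad E h x - grad E h y" "grad E h y"] by simp
    also have "dual_norm E N (grad E h x - grad E h y) \<le> l * N (x - y)"
      using sm x y by (simp add: smooth_on_def)
    also have "\<dots> \<le> l * diam N X" by (intro mult_left_mono N_le_diam X x y l)
    finally show "dual_norm E N (grad E h x) - l * diam N X \<le> dual_norm E N (grad E h y)" by simp
  qed
  then show ?thesis by simp
qed

lemma smooth_on_lipschitz:
  assumes sm: "smooth_on E N X l h" and l: "0 \<le> l" and X: "X \<subseteq> E" "compact X" "convex X"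
    and x: "x \<in> X" and y: "y \<in> X"
  shows "h y - h x \<le> (l * diam N X + (INF z\<in>X. dual_norm E N (grad E h z))) * N (y - x)"
proof -
  let ?p = "\<lambda>t. x + t *\<^sub>R (y - x)"
  have pX: "?p t \<in> X" if "t \<in> {0..1}" for t
  proof -
    have "?p t = (1 - t) *\<^sub>R x + t *\<^sub>R y" by (simp add: algebra_simps)
    then show ?thesis using convexD_alt[OF X(3) x y, of t] that by simp
  qed
  have der: "((\<lambda>t. h (?p t)) has_derivative (\<lambda>s. grad E h (?p t) \<bullet> (s *\<^sub>R (y - x)))) (at t within {0..1})"
    if t: "0 \<le> t" "t \<le> 1" for t
  proof -
    have pt: "?p t \<in> X" using pX t by simp
    have "(h has_derivative (\<lambda>v. grad E h (?p t) \<bullet> v)) (at (?p t) within ?p ` {0..1})"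
      using is_grad_grad[OF sm pt] pX X(1) unfolding is_grad_def
      by (elim conjE has_derivative_subset) auto
    then show ?thesis
      by (rule has_derivative_in_compose[rotated]) (auto intro!: derivative_eq_intros)
  qed
  obtain t where t: "t \<in> {0..1}" and
    eq: "h (?p 1) - h (?p 0) = grad E h (?p t) \<bullet> ((1 - 0) *\<^sub>R (y - x))"
    using mvt_very_simple[of 0 1 "\<lambda>t. h (?p t)" "\<lambda>t s. grad E h (?p t) \<bullet> (s *\<^sub>R (y - x))"] der by auto
  have yx: "y - x \<in> E" using x y X(1) by (intro subspace_diff[OF subspace]) auto
  have "h y - h x = grad E h (?p t) \<bullet> (y - x)" using eq by simp
  also have "\<dots> \<le> dual_norm E N (grad E h (?p t)) * N (y - x)" by (rule inner_le_dual_norm[OF yx])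
  also have "\<dots> \<le> (l * diam N X + (INF z\<in>X. dual_norm E N (grad E h z))) * N (y - x)"
    by (intro mult_right_mono dual_norm_grad_le[OF sm l X(1,2) pX[OF t]] N_nonneg yx)
  finally show ?thesis .
qed

end

section \<open>The Lagrangian and its dual function\<close>

lemma strongly_convex_onD:
  assumes "strongly_convex_on N X m h" "x \<in> X" "y \<in> X" "0 \<le> t" "t \<le> 1"
  shows "h ((1 - t) *\<^sub>R x + t *\<^sub>R y) \<le> (1 - t) * h x + t * h y - m / 2 * t * (1 - t) * (N (x - y))\<^sup>2"
  using assms unfolding strongly_convex_on_def by (metis atLeastAtMost_iff)

locale lagrangian_problem =
  fixes P :: "'v::real_inner problem"
  assumes valid: "valid_problem P"
begin

sublocale findim_normed "Es P" "nrm P"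
  using valid by unfold_locales (auto simp: valid_problem_def)

lemma X: "Xs P \<subseteq> Es P" "compact (Xs P)" "convex (Xs P)" "Xs P \<noteq> {}"
  and mu_pos: "0 < mu P" and mu_le_Lf: "mu P \<le> Lf P"
  and nc_ge_1: "1 \<le> nc P"
  using valid by (auto simp: valid_problem_def)

lemma constraint:
  assumes "i \<in> {1..nc P}"
  shows "0 \<le> al P i" "convex_on (Xs P) (gc P i)"
    "smooth_on (Es P) (nrm P) (Xs P) (al P i) (gc P i)"
  using valid assms unfolding valid_problem_def by blast+

lemma diff_in_Es: "x \<in> Xs P \<Longrightarrow> y \<in> Xs P \<Longrightarrow> x - y \<in> Es P"
  using X(1) by (intro subspace_diff[OF subspace]) auto

lemma segment_in_X: "x \<in> Xs P \<Longrightarrow> y \<in> Xs P \<Longrightarrow> 0 \<le> t \<Longrightarrow> t \<le> 1 \<Longrightarrow> (1 - t) *\<^sub>R x + t *\<^sub>R y \<in> Xs P"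
  using convexD_alt[OF X(3)] by blast

lemma Mi_nonneg:
  assumes i: "i \<in> {1..nc P}"
  shows "0 \<le> Mi P i"
proof -
  obtain x where x: "x \<in> Xs P" using X(4) by blast
  have "0 \<le> nrm P (x - x)" by (rule N_nonneg[OF diff_in_Es[OF x x]])
  also have "\<dots> \<le> diam (nrm P) (Xs P)" by (rule N_le_diam[OF X(1,2) x x])
  finally have "0 \<le> diam (nrm P) (Xs P)" .
  moreover have "0 \<le> (INF x\<in>Xs P. dual_norm (Es P) (nrm P) (grad (Es P) (gc P i) x))"
    by (rule cINF_greatest[OF X(4)]) (rule dual_norm_nonneg)
  ultimately show ?thesis using constraint(1)[OF i] by (simp add: Mi_def)
qed

lemma Msum_nonneg: "0 \<le> Msum P"
  unfolding Msum_def by (intro sum_nonneg Mi_nonneg)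

lemma alpha_nonneg: "0 \<le> alpha P"
  unfolding alpha_def using constraint(1) by (intro sum_nonneg) auto

lemma constraint_lipschitz:
  assumes i: "i \<in> {1..nc P}" and x: "x \<in> Xs P" and y: "y \<in> Xs P"
  shows "\<bar>gc P i x - gc P i y\<bar> \<le> Mi P i * nrm P (x - y)"
proof -
  note lip = smooth_on_lipschitz[OF constraint(3)[OF i] constraint(1)[OF i] X(1-3), folded Mi_def]
  have "nrm P (y - x) = nrm P (x - y)"
    using x y X(1) by (intro norm_on_diff_commute[OF subspace norm_on]) auto
  then show ?thesis using lip[OF x y] lip[OF y x] by simp
qed

lemma ro_finite: "x \<in> Xs P \<Longrightarrow> \<bar>ro P x\<bar> \<noteq> \<infinity>"
  using valid by (auto simp: valid_problem_def convex_closed_proper_def edom_def)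

lemma dg_finite: "x \<in> Xs P \<Longrightarrow> \<bar>dg P x\<bar> \<noteq> \<infinity>"
  using valid by (auto simp: valid_problem_def dgf_def convex_closed_proper_def edom_def)

lemma ro_convex:
  assumes x: "x \<in> Xs P" and y: "y \<in> Xs P" and t: "0 \<le> t" "t \<le> 1"
  shows "real_of_ereal (ro P ((1 - t) *\<^sub>R x + t *\<^sub>R y))
    \<le> (1 - t) * real_of_ereal (ro P x) + t * real_of_ereal (ro P y)"
proof -
  have "convex (epigraph (Es P) (ro P))"
    using valid by (simp add: valid_problem_def convex_closed_proper_def)
  moreover have "(x, real_of_ereal (ro P x)) \<in> epigraph (Es P) (ro P)"
      "(y, real_of_ereal (ro P y)) \<in> epigraph (Es P) (ro P)"
    using x y X(1) ro_finite by (auto simp: epigraph_def ereal_real)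
  ultimately have "(1 - t) *\<^sub>R (x, real_of_ereal (ro P x)) + t *\<^sub>R (y, real_of_ereal (ro P y))
      \<in> epigraph (Es P) (ro P)"
    using t by (intro convexD_alt) auto
  then have "ro P ((1 - t) *\<^sub>R x + t *\<^sub>R y)
      \<le> ereal ((1 - t) * real_of_ereal (ro P x) + t * real_of_ereal (ro P y))"
    by (simp add: epigraph_def)
  then show ?thesis
    using ro_finite[OF segment_in_X[OF x y t]]
    by (cases "ro P ((1 - t) *\<^sub>R x + t *\<^sub>R y)") auto
qed

text \<open>
  The prox problem with \<open>\<upsilon> = 0\<close> and \<open>a = 1\<close> has a solution, so \<open>r + \<omega>\<close> is bounded below on \<open>X\<close>,
  while the continuous function \<open>\<omega>\<close> is bounded above there.
\<close>

lemma ro_bdd_below: "\<exists>c. \<forall>x\<in>Xs P. c \<le> real_of_ereal (ro P x)"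
proof -
  have dgf: "dgf (Es P) (nrm P) (Xs P) (ro P) (dg P)" using valid by (simp add: valid_problem_def)
  have "continuous_on (Xs P) (dg P)" using dgf by (simp add: dgf_def)
  then obtain s where s: "s \<in> Xs P" "\<forall>x\<in>Xs P. dg P x \<le> dg P s"
    using continuous_attains_sup[OF X(2,4)] by blast
  obtain z where z: "z \<in> Xs P" "\<And>y. y \<in> Xs P \<Longrightarrow> y \<noteq> z \<Longrightarrow>
      real_of_ereal (ro P z) + real_of_ereal (dg P z) < real_of_ereal (ro P y) + real_of_ereal (dg P y)"
  proof -
    have "\<forall>a>0. \<forall>v\<in>Es P. \<exists>x\<in>Xs P \<inter> int_edom (Es P) (dg P). \<forall>y\<in>Xs P. y \<noteq> x \<longrightarrow>
        real_of_ereal (ro P x) + v \<bullet> x + real_of_ereal (dg P x) / a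
          < real_of_ereal (ro P y) + v \<bullet> y + real_of_ereal (dg P y) / a"
      using dgf unfolding dgf_def by blast
    from this[rule_format, of 1 0] show ?thesis using that subspace_0[OF subspace] by auto
  qed
  have "real_of_ereal (ro P z) + real_of_ereal (dg P z) - real_of_ereal (dg P s) \<le> real_of_ereal (ro P x)"
    if x: "x \<in> Xs P" for x
  proof -
    have "real_of_ereal (dg P x) \<le> real_of_ereal (dg P s)"
      using s(2) x dg_finite[OF x] dg_finite[OF s(1)]
      by (cases "dg P x"; cases "dg P s") auto
    then show ?thesis using z(2)[OF x] by (cases "x = z") auto
  qed
  then show ?thesis by blast
qed

text \<open>Without this, the infimum defining the dual function would be an unspecified number.\<close>

lemma bdd_below_lagr: "bdd_below ((\<lambda>x. lagr P x l) ` Xs P)"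
proof -
  obtain c where c: "\<forall>x\<in>Xs P. c \<le> real_of_ereal (ro P x)" using ro_bdd_below by blast
  have "smooth_on (Es P) (nrm P) (Xs P) (Lf P) (fo P)" using valid by (simp add: valid_problem_def)
  then have "continuous_on (Xs P) (\<lambda>x. fo P x + (\<Sum>i=1..nc P. l i * gc P i x))"
    using constraint(3) by (intro continuous_intros continuous_on_smooth_on[OF _ X(1)])
  then obtain s where s: "s \<in> Xs P" "\<forall>x\<in>Xs P. fo P s + (\<Sum>i=1..nc P. l i * gc P i s)
      \<le> fo P x + (\<Sum>i=1..nc P. l i * gc P i x)"
    using continuous_attains_inf[OF X(2,4)] by blast
  show ?thesis
  proof (rule bdd_belowI2)
    fix x assume "x \<in> Xs P"
    then show "fo P s + (\<Sum>i=1..nc P. l i * gc P i s) + c \<le> lagr P x l"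
      using s(2) c by (fastforce simp: lagr_def)
  qed
qed

lemma dual_fun_le: "x \<in> Xs P \<Longrightarrow> dual_fun P l \<le> lagr P x l"
  unfolding dual_fun_def by (rule cINF_lower[OF bdd_below_lagr])

lemma lagr_strongly_convex:
  assumes l: "l \<in> multipliers P"
  shows "strongly_convex_on (nrm P) (Xs P) (mu P) (\<lambda>x. lagr P x l)"
  unfolding strongly_convex_on_def
proof (intro ballI)
  fix x y t assume x: "x \<in> Xs P" and y: "y \<in> Xs P" and t: "t \<in> {0..(1::real)}"
  have f: "fo P ((1 - t) *\<^sub>R x + t *\<^sub>R y)
      \<le> (1 - t) * fo P x + t * fo P y - mu P / 2 * t * (1 - t) * (nrm P (x - y))\<^sup>2"
    using valid x y t by (simp add: valid_problem_def strongly_convex_on_def)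
  have r: "real_of_ereal (ro P ((1 - t) *\<^sub>R x + t *\<^sub>R y))
      \<le> (1 - t) * real_of_ereal (ro P x) + t * real_of_ereal (ro P y)"
    using ro_convex[OF x y] t by simp
  have "(\<Sum>i=1..nc P. l i * gc P i ((1 - t) *\<^sub>R x + t *\<^sub>R y))
      \<le> (\<Sum>i=1..nc P. l i * ((1 - t) * gc P i x + t * gc P i y))"
    using l x y t constraint(2) convex_onD
    by (intro sum_mono mult_left_mono) (fastforce simp: multipliers_def)+
  also have "\<dots> = (1 - t) * (\<Sum>i=1..nc P. l i * gc P i x) + t * (\<Sum>i=1..nc P. l i * gc P i y)"
    by (simp add: sum_distrib_left sum.distrib[symmetric] algebra_simps)
  finally show "lagr P ((1 - t) *\<^sub>R x + t *\<^sub>R y) l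
      \<le> (1 - t) * lagr P x l + t * lagr P y l - mu P / 2 * t * (1 - t) * (nrm P (x - y))\<^sup>2"
    using f r by (simp add: lagr_def algebra_simps)
qed

lemma lagr_convex:
  assumes l: "l \<in> multipliers P" and x: "x \<in> Xs P" and y: "y \<in> Xs P" and t: "0 \<le> t" "t \<le> 1"
  shows "lagr P (t *\<^sub>R x + (1 - t) *\<^sub>R y) l \<le> t * lagr P x l + (1 - t) * lagr P y l"
proof -
  have "lagr P ((1 - (1 - t)) *\<^sub>R x + (1 - t) *\<^sub>R y) l
      \<le> (1 - (1 - t)) * lagr P x l + (1 - t) * lagr P y l
        - mu P / 2 * (1 - t) * (1 - (1 - t)) * (nrm P (x - y))\<^sup>2"
    by (rule strongly_convex_onD[OF lagr_strongly_convex[OF l] x y]) (use t in simp_all)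
  moreover have "0 \<le> mu P / 2 * (1 - t) * t * (nrm P (x - y))\<^sup>2"
    using mu_pos t by simp
  ultimately show ?thesis by simp
qed

text \<open>
  An approximate minimizer \<open>z\<close> of \<open>S(\<cdot>, l)\<close> yields a quadratic minorant of the dual function around
  \<open>l\<close>, as for a smooth concave function with supergradient \<open>g(z)\<close>. Moving from \<open>l\<close> to \<open>l'\<close> tilts
  the objective by a function with Lipschitz constant at most \<open>M \<parallel>l' - l\<parallel>\<^sub>2\<close>, and strong convexity
  absorbs the tilt. Comparing \<open>z\<close> with the midpoint of \<open>z\<close> and \<open>x\<close>, instead of with the exact
  minimizer, turns strong convexity into the growth \<open>\<mu>/4 * N(z - x)\<^sup>2 - 2\<gamma>\<close>; the price is the
  coefficient \<open>L\<^sub>D\<close> in place of \<open>L\<^sub>D / 2\<close>.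
\<close>

lemma dual_fun_lower_bound:
  assumes l: "l \<in> multipliers P" and z: "z \<in> Xs P" and acc: "lagr P z l - dual_fun P l \<le> \<gamma>"
  shows "lagr P z l' - 2 * \<gamma> - LD P * (\<Sum>i=1..nc P. (l' i - l i)\<^sup>2) \<le> dual_fun P l'"
  unfolding dual_fun_def
proof (rule cINF_greatest[OF X(4)])
  fix x assume x: "x \<in> Xs P"
  define d where "d = nrm P (z - x)"
  define s where "s = L2_set (\<lambda>i. l' i - l i) {1..nc P}"
  have d0: "0 \<le> d" unfolding d_def by (rule N_nonneg[OF diff_in_Es[OF z x]])
  have "lagr P ((1 - 1/2) *\<^sub>R z + (1/2) *\<^sub>R x) l
      \<le> (1 - 1/2) * lagr P z l + (1/2) * lagr P x l - mu P / 2 * (1/2) * (1 - 1/2) * d\<^sup>2"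
    unfolding d_def by (rule strongly_convex_onD[OF lagr_strongly_convex[OF l] z x]) simp_all
  moreover have "dual_fun P l \<le> lagr P ((1 - 1/2) *\<^sub>R z + (1/2) *\<^sub>R x) l"
    using segment_in_X[OF z x, of "1/2"] by (intro dual_fun_le) simp
  ultimately have growth: "lagr P z l - 2 * \<gamma> + mu P / 4 * d\<^sup>2 \<le> lagr P x l"
    using acc by simp
  have "(\<Sum>i=1..nc P. (l' i - l i) * (gc P i z - gc P i x)) \<le> (\<Sum>i=1..nc P. s * (Mi P i * d))"
  proof (rule sum_mono)
    fix i assume i: "i \<in> {1..nc P}"
    have "(l' i - l i) * (gc P i z - gc P i x) \<le> \<bar>l' i - l i\<bar> * \<bar>gc P i z - gc P i x\<bar>"
      using abs_ge_self by (metis abs_mult)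
    also have "\<dots> \<le> s * (Mi P i * d)"
    proof (rule mult_mono)
      have "\<bar>l' i - l i\<bar> = sqrt ((l' i - l i)\<^sup>2)" by simp
      also have "\<dots> \<le> s" unfolding s_def L2_set_def
        by (intro real_sqrt_le_mono member_le_sum) (use i in auto)
      finally show "\<bar>l' i - l i\<bar> \<le> s" .
      show "\<bar>gc P i z - gc P i x\<bar> \<le> Mi P i * d"
        unfolding d_def by (rule constraint_lipschitz[OF i z x])
      show "0 \<le> s" by (simp add: s_def L2_set_nonneg)
    qed simp
    finally show "(l' i - l i) * (gc P i z - gc P i x) \<le> s * (Mi P i * d)" .
  qed
  also have "\<dots> = s * Msum P * d" by (simp add: Msum_def sum_distrib_left sum_distrib_right mult.assoc)
  finally have "lagr P z l' - lagr P z l - (lagr P x l' - lagr P x l) \<le> s * Msum P * d"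
    by (simp add: lagr_def sum_subtractf sum.distrib algebra_simps)
  moreover have "s * Msum P * d \<le> mu P / 4 * d\<^sup>2 + LD P * s\<^sup>2"
  proof -
    (* Young's inequality *)
    have "0 \<le> (mu P * d / 2 - s * Msum P)\<^sup>2 / mu P" using mu_pos by simp
    also have "\<dots> = mu P / 4 * d\<^sup>2 + LD P * s\<^sup>2 - s * Msum P * d"
      using mu_pos by (simp add: LD_def field_simps power2_eq_square)
    finally show ?thesis by simp
  qed
  moreover have "s\<^sup>2 = (\<Sum>i=1..nc P. (l' i - l i)\<^sup>2)"
    unfolding s_def L2_set_def by (simp add: sum_nonneg)
  ultimately show "lagr P z l' - 2 * \<gamma> - LD P * (\<Sum>i=1..nc P. (l' i - l i)\<^sup>2) \<le> lagr P x l'"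
    using growth by simp
qed

end

section \<open>The excessive gap\<close>

text \<open>
  The smoothed primal function \<open>sup\<^bsub>l' \<ge> 0\<^esub> (S(x, l') - \<rho>/2 * \<parallel>l'\<parallel>\<^sup>2)\<close>, evaluated in closed form: it is
  the quadratic penalty function of the problem.
\<close>

definition penalty_obj :: "'v::real_inner problem \<Rightarrow> real \<Rightarrow> 'v \<Rightarrow> real" where
  "penalty_obj P \<rho> x = obj P x + (\<Sum>i=1..nc P. (pos (gc P i x))\<^sup>2) / (2 * \<rho>)"

lemma lam_tilde_multipliers: "0 < \<rho> \<Longrightarrow> lam_tilde P \<rho> x \<in> multipliers P"
  by (auto simp: multipliers_def lam_tilde_def pos_def)

lemma multipliers_combine:
  "l \<in> multipliers P \<Longrightarrow> m \<in> multipliers P \<Longrightarrow> 0 \<le> a \<Longrightarrow> 0 \<le> b \<Longrightarrow>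
    (\<lambda>i. a * l i + b * m i) \<in> multipliers P"
  by (auto simp: multipliers_def)

lemma lagr_combine:
  assumes "a + b = 1"
  shows "lagr P x (\<lambda>i. a * l i + b * m i) = a * lagr P x l + b * lagr P x m"
proof -
  have b: "b = 1 - a" using assms by simp
  have "(\<Sum>i=1..nc P. (a * l i + b * m i) * gc P i x)
      = a * (\<Sum>i=1..nc P. l i * gc P i x) + b * (\<Sum>i=1..nc P. m i * gc P i x)"
    by (simp add: sum_distrib_left sum.distrib[symmetric] algebra_simps)
  then show ?thesis unfolding lagr_def b by (simp add: algebra_simps)
qed

lemma lagr_eq_obj: "lagr P x l = obj P x + (\<Sum>i=1..nc P. l i * gc P i x)"
  by (simp add: lagr_def obj_def)

lemma penalty_obj_eq:
  assumes "0 < \<rho>"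
  shows "penalty_obj P \<rho> x
    = lagr P x (lam_tilde P \<rho> x) - \<rho> / 2 * (\<Sum>i=1..nc P. (lam_tilde P \<rho> x i)\<^sup>2)"
proof -
  have "(\<Sum>i=1..nc P. (pos (gc P i x))\<^sup>2 / (2 * \<rho>))
    = (\<Sum>i=1..nc P. lam_tilde P \<rho> x i * gc P i x - \<rho> / 2 * (lam_tilde P \<rho> x i)\<^sup>2)"
    by (rule sum.cong)
      (use assms in \<open>auto simp: lam_tilde_def pos_def max_def field_simps power2_eq_square\<close>)
  then show ?thesis
    by (simp add: penalty_obj_def lagr_eq_obj sum_subtractf sum_distrib_left sum_divide_distrib)
qed

text \<open>
  The supremum is that of a \<open>\<rho>\<close>-strongly concave function with maximizer \<open>lam_tilde\<close>, so a competitor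
  \<open>m\<close> falls short of it quadratically. This quadratic term pays for the curvature of the dual
  function in \<open>excessive_gap_step\<close>.
\<close>

lemma penalty_obj_ge:
  assumes \<rho>: "0 < \<rho>" and m: "m \<in> multipliers P"
  shows "lagr P x m - \<rho> / 2 * (\<Sum>i=1..nc P. (m i)\<^sup>2)
      + \<rho> / 2 * (\<Sum>i=1..nc P. (m i - lam_tilde P \<rho> x i)\<^sup>2) \<le> penalty_obj P \<rho> x"
proof -
  have "(\<Sum>i=1..nc P. m i * gc P i x - \<rho> / 2 * (m i)\<^sup>2 + \<rho> / 2 * (m i - lam_tilde P \<rho> x i)\<^sup>2)
      \<le> (\<Sum>i=1..nc P. (pos (gc P i x))\<^sup>2 / (2 * \<rho>))"
  proof (rule sum_mono)
    fix i assume i: "i \<in> {1..nc P}"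
    have "m i * gc P i x \<le> m i * pos (gc P i x)"
      using m i by (intro mult_left_mono) (auto simp: multipliers_def pos_def)
    moreover have "m i * pos (gc P i x) - \<rho> / 2 * (m i)\<^sup>2 + \<rho> / 2 * (m i - lam_tilde P \<rho> x i)\<^sup>2
        = (pos (gc P i x))\<^sup>2 / (2 * \<rho>)"
      using i \<rho> by (simp add: lam_tilde_def field_simps power2_eq_square)
    ultimately show "m i * gc P i x - \<rho> / 2 * (m i)\<^sup>2 + \<rho> / 2 * (m i - lam_tilde P \<rho> x i)\<^sup>2
        \<le> (pos (gc P i x))\<^sup>2 / (2 * \<rho>)" by linarith
  qed
  then show ?thesis
    by (simp add: penalty_obj_def lagr_eq_obj sum_subtractf sum.distrib sum_distrib_left sum_divide_distrib)
qed

lemma penalty_gap_le_Delta: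
  assumes \<rho>: "0 < \<rho>"
  shows "penalty_obj P \<rho> x - dual_fun P l \<le> Delta P \<rho> x l"
proof -
  let ?h = "\<lambda>m. lagr P x m - \<rho> / 2 * (\<Sum>i=1..nc P. (m i)\<^sup>2)"
  have "?h m \<le> penalty_obj P \<rho> x" if "m \<in> multipliers P" for m
  proof -
    have "0 \<le> \<rho> / 2 * (\<Sum>i=1..nc P. (m i - lam_tilde P \<rho> x i)\<^sup>2)" using \<rho> by (simp add: sum_nonneg)
    then show ?thesis using penalty_obj_ge[OF \<rho> that, of x] by linarith
  qed
  then have "bdd_above (?h ` multipliers P)" by (rule bdd_aboveI2)
  then have "?h (lam_tilde P \<rho> x) \<le> (SUP m\<in>multipliers P. ?h m)"
    by (intro cSUP_upper lam_tilde_multipliers \<rho>)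
  then show ?thesis using penalty_obj_eq[OF \<rho>, of P x] by (simp add: Delta_def)
qed

text \<open>
  One iteration contracts the gap by the factor \<open>t\<close>, up to the inexactness. The new penalty value
  is split by convexity of \<open>S\<close> in \<open>x\<close>, the new dual value is bounded below at
  \<open>lh\<close> and split by linearity of \<open>S\<close> in \<open>l\<close>. The terms \<open>S(z, m')\<close> cancel, because the two
  updates use the same weights, and \<open>l' - lh\<close> is \<open>1 - t\<close> times the change of the penalty
  multipliers. What remains is a multiple of the square of that change, with opposite signs on the
  two sides; \<open>stepsize\<close> makes it disappear.
\<close>

lemma (in lagrangian_problem) excessive_gap_step:
  assumes \<rho>: "0 < \<rho>" and t: "0 < t" "t \<le> 1" and stepsize: "LD P * (1 - t)\<^sup>2 \<le> t * \<rho> / 2"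
    and x: "x \<in> Xs P" and z: "z \<in> Xs P" and l: "l \<in> multipliers P"
    and lh: "lh = (\<lambda>i. t * l i + (1 - t) * lam_tilde P \<rho> x i)"
    and acc: "lagr P z lh - dual_fun P lh \<le> \<gamma>"
    and x': "x' = t *\<^sub>R x + (1 - t) *\<^sub>R z"
    and l': "l' = (\<lambda>i. t * l i + (1 - t) * lam_tilde P (t * \<rho>) x' i)"
  shows "penalty_obj P (t * \<rho>) x' - dual_fun P l' \<le> t * (penalty_obj P \<rho> x - dual_fun P l) + 2 * \<gamma>"
proof -
  define m where "m = lam_tilde P \<rho> x"
  define m' where "m' = lam_tilde P (t * \<rho>) x'"
  define D where "D = (\<Sum>i=1..nc P. (m' i - m i)\<^sup>2)"
  have m: "m \<in> multipliers P" "m' \<in> multipliers P"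
    unfolding m_def m'_def using \<rho> t by (auto intro: lam_tilde_multipliers)
  have lh_mult: "lh \<in> multipliers P"
    unfolding lh m_def[symmetric] using l m t by (intro multipliers_combine) auto
  have "(\<Sum>i=1..nc P. (l' i - lh i)\<^sup>2) = (\<Sum>i=1..nc P. (1 - t)\<^sup>2 * (m' i - m i)\<^sup>2)"
    by (intro sum.cong) (auto simp: l' lh m_def m'_def power2_eq_square algebra_simps)
  then have "(\<Sum>i=1..nc P. (l' i - lh i)\<^sup>2) = (1 - t)\<^sup>2 * D" by (simp add: D_def sum_distrib_left)
  then have dual: "lagr P z l' - 2 * \<gamma> - LD P * ((1 - t)\<^sup>2 * D) \<le> dual_fun P l'"
    using dual_fun_lower_bound[OF lh_mult z acc, of l'] by simp
  have "lagr P z l' = t * lagr P z l + (1 - t) * lagr P z m'"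
    unfolding l' m'_def[symmetric] by (rule lagr_combine) simp
  moreover have "t * dual_fun P l \<le> t * lagr P z l" using t dual_fun_le[OF z] by (intro mult_left_mono) auto
  ultimately have dual': "t * dual_fun P l + (1 - t) * lagr P z m' - 2 * \<gamma> - LD P * (1 - t)\<^sup>2 * D
      \<le> dual_fun P l'"
    using dual by (simp add: mult.assoc)
  have "penalty_obj P (t * \<rho>) x' = lagr P x' m' - t * \<rho> / 2 * (\<Sum>i=1..nc P. (m' i)\<^sup>2)"
    unfolding m'_def using \<rho> t by (intro penalty_obj_eq) simp
  also have "lagr P x' m' \<le> t * lagr P x m' + (1 - t) * lagr P z m'"
    unfolding x' using m x z t by (intro lagr_convex) auto
  finally have "penalty_obj P (t * \<rho>) x'
      \<le> t * (lagr P x m' - \<rho> / 2 * (\<Sum>i=1..nc P. (m' i)\<^sup>2)) + (1 - t) * lagr P z m'"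
    by (simp add: algebra_simps)
  also have "t * (lagr P x m' - \<rho> / 2 * (\<Sum>i=1..nc P. (m' i)\<^sup>2)) \<le> t * (penalty_obj P \<rho> x - \<rho> / 2 * D)"
    using penalty_obj_ge[OF \<rho> m(2), of x] t unfolding D_def m_def by (intro mult_left_mono) auto
  finally have primal: "penalty_obj P (t * \<rho>) x'
      \<le> t * penalty_obj P \<rho> x - t * \<rho> / 2 * D + (1 - t) * lagr P z m'" by (simp add: algebra_simps)
  have "LD P * (1 - t)\<^sup>2 * D \<le> t * \<rho> / 2 * D"
    using stepsize by (intro mult_right_mono) (auto simp: D_def sum_nonneg)
  then show ?thesis using primal dual' by (simp add: algebra_simps)
qed

section \<open>Convergence of the excessive gap\<close>

text \<open>
  For a multiplier vector this is \<open>\<parallel>l\<parallel>\<^sub>2\<^sup>2\<close>. Summing over the support, rather than over \<open>{1..n}\<close>, makes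
  it a function of \<open>l\<close> alone, so that it can enter the implied constant.
\<close>

definition support_sq_sum :: "(nat \<Rightarrow> real) \<Rightarrow> real" where
  "support_sq_sum l = (\<Sum>i | l i \<noteq> 0. (l i)\<^sup>2)"

lemma support_sum_multipliers:
  assumes "l \<in> multipliers P" "h 0 = 0"
  shows "(\<Sum>i | l i \<noteq> 0. h (l i)) = (\<Sum>i=1..nc P. h (l i) :: real)"
  using assms by (intro sum.mono_neutral_left) (auto simp: multipliers_def)

lemma (in lagrangian_problem) dual_fun_le_optimal:
  assumes opt: "optimal P xs" and l: "l \<in> multipliers P"
  shows "dual_fun P l \<le> obj P xs"
proof -
  have "(\<Sum>i=1..nc P. l i * gc P i xs) \<le> 0"
    using opt l by (intro sum_nonpos mult_nonneg_nonpos) (auto simp: optimal_def multipliers_def)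
  then show ?thesis using dual_fun_le[of xs l] opt by (simp add: optimal_def lagr_eq_obj)
qed

lemma saddle_point_obj_le:
  assumes "saddle_point P xs ls" "x \<in> Xs P"
  shows "obj P xs \<le> lagr P x ls"
proof -
  have "(\<lambda>_. 0) \<in> multipliers P" by (simp add: multipliers_def)
  then have "lagr P xs (\<lambda>_. 0) \<le> lagr P x ls"
    using assms unfolding saddle_point_def by (meson order_trans)
  then show ?thesis by (simp add: lagr_eq_obj)
qed

text \<open>
  The objective can fall below its optimal value by at most \<open>\<Sum>\<^sub>i l\<^sup>*\<^sub>i [g\<^sub>i(x)]\<^sub>+\<close>, by the saddle point
  property. This is linear in the violation, whereas the penalty is quadratic; completing the square
  with half of the penalty leaves the other half as a lower bound of the gap.
\<close>

lemma (in lagrangian_problem) violation_le_gap: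
  assumes opt: "optimal P xs" and saddle: "saddle_point P xs ls"
    and \<rho>: "0 < \<rho>" and x: "x \<in> Xs P" and l: "l \<in> multipliers P" and j: "j \<in> {1..nc P}"
  shows "(pos (gc P j x))\<^sup>2 \<le> 4 * \<rho> * (penalty_obj P \<rho> x - dual_fun P l + \<rho> * support_sq_sum ls)"
proof -
  let ?p = "\<lambda>i. pos (gc P i x)"
  have ls: "ls \<in> multipliers P" using saddle by (simp add: saddle_point_def)
  have "(?p j)\<^sup>2 / (4 * \<rho>) \<le> (\<Sum>i=1..nc P. (?p i)\<^sup>2 / (4 * \<rho>))"
    using j \<rho> by (intro member_le_sum[where f = "\<lambda>i. (?p i)\<^sup>2 / (4 * \<rho>)"]) auto
  also have "\<dots> \<le> (\<Sum>i=1..nc P. (?p i)\<^sup>2 / (2 * \<rho>) - ls i * gc P i x + \<rho> * (ls i)\<^sup>2)"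
  proof (rule sum_mono)
    fix i assume i: "i \<in> {1..nc P}"
    have "ls i * gc P i x \<le> ls i * ?p i"
      using ls i by (intro mult_left_mono) (auto simp: multipliers_def pos_def)
    moreover have "0 \<le> (?p i - 2 * \<rho> * ls i)\<^sup>2 / (4 * \<rho>)" using \<rho> by simp
    moreover have "(?p i - 2 * \<rho> * ls i)\<^sup>2 / (4 * \<rho>)
        = (?p i)\<^sup>2 / (2 * \<rho>) - (?p i)\<^sup>2 / (4 * \<rho>) - ls i * ?p i + \<rho> * (ls i)\<^sup>2"
      using \<rho> by (simp add: field_simps power2_eq_square)
    ultimately show "(?p i)\<^sup>2 / (4 * \<rho>) \<le> (?p i)\<^sup>2 / (2 * \<rho>) - ls i * gc P i x + \<rho> * (ls i)\<^sup>2"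
      by linarith
  qed
  also have "\<dots> = penalty_obj P \<rho> x - lagr P x ls + \<rho> * support_sq_sum ls"
    using support_sum_multipliers[OF ls, of "\<lambda>a. a\<^sup>2"]
    by (simp add: penalty_obj_def lagr_eq_obj support_sq_sum_def sum.distrib sum_subtractf
        sum_distrib_left sum_divide_distrib)
  also have "\<dots> \<le> penalty_obj P \<rho> x - dual_fun P l + \<rho> * support_sq_sum ls"
    using dual_fun_le_optimal[OF opt l] saddle_point_obj_le[OF saddle x] by simp
  finally show ?thesis using \<rho> by (simp add: field_simps)
qed

text \<open>
  Here \<open>E\<close> stands for any upper bound of the required reduction factor \<open>L' D / (4 e)\<close> that is at
  least 1; it also covers the degenerate case \<open>D \<le> 0\<close>. The rate follows from
  \<open>2 ln (1 + q) \<ge> q\<close> for \<open>0 < q \<le> 1\<close>.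
\<close>

lemma apg_iters_bound:
  assumes \<mu>': "0 < \<mu>'" "\<mu>' \<le> L'" and e: "0 < e" and E: "1 \<le> E" "L' * D / 4 \<le> e * E"
  defines "T \<equiv> LEAST t. 1 \<le> t \<and> apg_bound L' \<mu>' D t \<le> e"
  shows "1 \<le> T" "apg_bound L' \<mu>' D T \<le> e" "real T \<le> 2 + sqrt (2 * (L' / \<mu>')) * ln E"
proof -
  define q where "q = 1 / sqrt (2 * (L' / \<mu>'))"
  have \<kappa>: "1 \<le> L' / \<mu>'" using \<mu>' by simp
  have q: "0 < q" "q \<le> 1" unfolding q_def using \<kappa> by auto
  have "ln (1 / (1 + q)) \<le> 1 / (1 + q) - 1" using q by (intro ln_le_minus_one) simp
  then have "q / (1 + q) \<le> ln (1 + q)" using q by (simp add: ln_div field_simps)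
  moreover have "q / 2 \<le> q / (1 + q)" using q by (intro divide_left_mono) auto
  ultimately have lnq: "q \<le> 2 * ln (1 + q)" by linarith
  define t where "t = nat \<lceil>ln E / q\<rceil> + 1"
  have lnE: "0 \<le> ln E / q" using E q by simp
  have t: "ln E / q \<le> real t - 1" "real t \<le> 2 + ln E / q" unfolding t_def using lnE by linarith+
  have "ln E \<le> (real t - 1) * q" using t q by (simp add: field_simps)
  also have "\<dots> \<le> (real t - 1) * (2 * ln (1 + q))"
    using lnq t lnE by (intro mult_left_mono) linarith+
  finally have "- 2 * (real t - 1) * ln (1 + q) \<le> - ln E" by (simp only: mult_ac mult_minus_left)
  then have "exp (- 2 * (real t - 1) * ln (1 + q)) \<le> exp (- ln E)" by (simp only: exp_le_cancel_iff)
  then have pw: "(1 + q) powr (- 2 * (real t - 1)) \<le> 1 / E"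
    using q E by (simp add: powr_def exp_minus inverse_eq_divide)
  have "apg_bound L' \<mu>' D t \<le> e"
  proof (cases "D \<le> 0")
    case True
    then have "apg_bound L' \<mu>' D t \<le> 0"
      unfolding apg_bound_def using \<mu>' by (intro mult_nonneg_nonpos) auto
    then show ?thesis using e by simp
  next
    case False
    have "apg_bound L' \<mu>' D t = L' * D / 4 * (1 + q) powr (- 2 * (real t - 1))"
      by (simp add: apg_bound_def q_def)
    also have "\<dots> \<le> L' * D / 4 * (1 / E)"
      using pw False \<mu>' by (intro mult_left_mono) auto
    also have "\<dots> \<le> e" using E by (simp add: field_simps)
    finally show ?thesis .
  qed
  moreover have "1 \<le> t" by (simp add: t_def)
  ultimately have ex: "1 \<le> t \<and> apg_bound L' \<mu>' D t \<le> e" by simp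
  show "1 \<le> T" "apg_bound L' \<mu>' D T \<le> e" 
    using LeastI[of "\<lambda>t. 1 \<le> t \<and> apg_bound L' \<mu>' D t \<le> e" t, OF ex] by (auto simp: T_def)
  have "T \<le> t" unfolding T_def using ex by (rule Least_le)
  then show "real T \<le> 2 + sqrt (2 * (L' / \<mu>')) * ln E" using t(2) by (simp add: q_def field_simps)
qed

text \<open>The product of the factors \<open>\<tau>\<^sub>j = (j + 1) / (j + 3)\<close> telescopes.\<close>

lemma rho_eq: "rho P k = 16 * LD P / ((real k + 1) * (real k + 2))"
proof (induction k)
  case (Suc k)
  have "rho P (Suc k) = (real k + 1) / (real k + 3) * (16 * LD P / ((real k + 1) * (real k + 2)))"
    using Suc by (simp add: tau_def)
  also have "\<dots> = 16 * LD P / ((real (Suc k) + 1) * (real (Suc k) + 2))"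
    by (simp add: divide_simps) (simp add: algebra_simps)
  finally show ?case .
qed simp

locale ipds_run = lagrangian_problem P for P :: "'v::real_inner problem" +
  fixes A :: "'v solver" and u0 xs x0 :: 'v and ls l0 :: "nat \<Rightarrow> real" and \<epsilon> :: real
  assumes LD_pos: "0 < LD P"
    and optimal: "optimal P xs" and saddle: "saddle_point P xs ls"
    and apg: "apg_guarantee P A u0"
    and x0: "x0 \<in> Xs P" and l0: "l0 \<in> multipliers P"
    and \<epsilon>_pos: "0 < \<epsilon>"
begin

definition x_it :: "nat \<Rightarrow> 'v" where "x_it k = fst (ipds P A u0 \<epsilon> x0 l0 k)"
definition l_it :: "nat \<Rightarrow> nat \<Rightarrow> real" where "l_it k = snd (ipds P A u0 \<epsilon> x0 l0 k)"
definition l_hat :: "nat \<Rightarrow> nat \<Rightarrow> real" where "l_hat k = lam_hat P k (ipds P A u0 \<epsilon> x0 l0 k)"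
definition inner_iters :: "nat \<Rightarrow> nat" where "inner_iters k = apg_iters P u0 (l_hat k) (gam \<epsilon> k)"
definition x_sub :: "nat \<Rightarrow> 'v" where "x_sub k = solver_iterate P A (l_hat k) (inner_iters k)"
definition gap :: "nat \<Rightarrow> real" where "gap k = penalty_obj P (rho P k) (x_it k) - dual_fun P (l_it k)"
definition gap_ratio :: real where "gap_ratio = pos (Delta P (rho P 0) x0 l0) / LD P"

lemma it_0: "x_it 0 = x0" "l_it 0 = l0" by (simp_all add: x_it_def l_it_def)

lemma l_hat_eq: "l_hat k = (\<lambda>i. tau k * l_it k i + (1 - tau k) * lam_tilde P (rho P k) (x_it k) i)"
  by (simp add: l_hat_def lam_hat_def l_it_def x_it_def case_prod_unfold)

lemma it_Suc:
  "x_it (Suc k) = tau k *\<^sub>R x_it k + (1 - tau k) *\<^sub>R x_sub k"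
  "l_it (Suc k) = (\<lambda>i. tau k * l_it k i + (1 - tau k) * lam_tilde P (rho P (Suc k)) (x_it (Suc k)) i)"
  by (simp_all add: x_it_def l_it_def x_sub_def l_hat_def inner_iters_def Let_def)

lemma rho_pos: "0 < rho P k" using LD_pos by (simp add: rho_eq)

lemma tau: "0 < tau k" "tau k \<le> 1" "1 - tau k = 2 / (real k + 3)"
  by (auto simp: tau_def field_simps)

lemma gam_pos: "0 < gam \<epsilon> k" using \<epsilon>_pos by (simp add: gam_def)

lemma l_it_mult: "l_it k \<in> multipliers P"
proof (induction k)
  case (Suc k)
  then show ?case unfolding it_Suc(2) using tau rho_pos
    by (intro multipliers_combine lam_tilde_multipliers) (auto simp: less_imp_le)
qed (simp add: it_0 l0)

lemma l_hat_mult: "l_hat k \<in> multipliers P"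
  unfolding l_hat_eq using tau rho_pos l_it_mult
  by (intro multipliers_combine lam_tilde_multipliers) (auto simp: less_imp_le)

lemma Lxx_nonneg: "l \<in> multipliers P \<Longrightarrow> 0 \<le> Lxx P l"
  unfolding Lxx_def using constraint(1) by (intro sum_nonneg mult_nonneg_nonneg) (auto simp: multipliers_def)

abbreviation "breg \<equiv> bregman_max (Es P) (Xs P) (dg P) u0"

lemma inner_iters_bound:
  assumes "1 \<le> E" "(Lf P + Lxx P (l_hat k)) * breg / 4 \<le> gam \<epsilon> k * E"
  shows "real (inner_iters k) \<le> 2 + sqrt (2 * ((Lf P + Lxx P (l_hat k)) / mu P)) * ln E"
  unfolding inner_iters_def apg_iters_def
  using assms mu_le_Lf Lxx_nonneg[OF l_hat_mult, of k] mu_pos gam_pos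
  by (intro apg_iters_bound(3)) auto

lemma x_sub: "x_sub k \<in> Xs P" "lagr P (x_sub k) (l_hat k) - dual_fun P (l_hat k) \<le> gam \<epsilon> k"
proof -
  define L' where "L' = Lf P + Lxx P (l_hat k)"
  define E where "E = max 1 (L' * breg / 4 / gam \<epsilon> k)"
  have "L' * breg / 4 / gam \<epsilon> k \<le> E" by (simp add: E_def)
  then have "L' * breg / 4 \<le> gam \<epsilon> k * E"
    using gam_pos[of k] by (simp only: pos_divide_le_eq mult.commute)
  moreover have "1 \<le> E" by (simp add: E_def)
  moreover have "0 < mu P" "mu P \<le> L'"
    using mu_pos mu_le_Lf Lxx_nonneg[OF l_hat_mult, of k] by (simp_all add: L'_def)
  ultimately have "1 \<le> inner_iters k" "apg_bound L' (mu P) breg (inner_iters k) \<le> gam \<epsilon> k"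
    unfolding inner_iters_def apg_iters_def L'_def[symmetric]
    using apg_iters_bound(1)[of "mu P" L' "gam \<epsilon> k" E breg] gam_pos[of k]
      apg_iters_bound(2)[of "mu P" L' "gam \<epsilon> k" E breg] by simp_all
  then show "x_sub k \<in> Xs P" "lagr P (x_sub k) (l_hat k) - dual_fun P (l_hat k) \<le> gam \<epsilon> k"
    using apg l_hat_mult[of k] unfolding apg_guarantee_def x_sub_def L'_def by force+
qed

lemma x_it: "x_it k \<in> Xs P"
proof (induction k)
  case (Suc k)
  show ?case unfolding it_Suc using segment_in_X[OF Suc x_sub(1)[of k], of "1 - tau k"] tau(1,2)[of k] by simp
qed (simp add: it_0 x0)

text \<open>
  The step-size condition holds because \<open>\<rho>\<^sub>k\<close> and \<open>(1 - \<tau>\<^sub>k)\<^sup>2\<close> both decay like \<open>k\<^sup>-\<^sup>2\<close>; the factor 8 in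
  \<open>\<rho>\<^sub>0\<close> balances the constants.
\<close>

lemma gap_Suc: "gap (Suc k) \<le> tau k * gap k + 2 * gam \<epsilon> k"
proof -
  have "LD P * (1 - tau k)\<^sup>2 = 4 * LD P / ((real k + 3) * (real k + 3))"
    unfolding tau(3) by (simp add: power2_eq_square)
  also have "\<dots> \<le> 8 * LD P / ((real k + 2) * (real k + 3))"
  proof -
    have "4 * LD P * (real k + 2) \<le> 8 * LD P * (real k + 3)" using LD_pos by (intro mult_mono) auto
    then have "4 * LD P / (real k + 3) \<le> 8 * LD P / (real k + 2)" by (simp add: field_simps)
    then have "4 * LD P / (real k + 3) / (real k + 3) \<le> 8 * LD P / (real k + 2) / (real k + 3)"
      by (intro divide_right_mono) auto
    then show ?thesis by simp
  qed
  also have "\<dots> = tau k * rho P k / 2"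
  proof -
    have "tau k * rho P k = rho P (Suc k)" by simp
    also have "\<dots> = 16 * LD P / ((real k + 2) * (real k + 3))"
      unfolding rho_eq by (simp add: add.commute)
    finally show ?thesis by simp
  qed
  finally show ?thesis
    unfolding gap_def rho.simps
    by (intro excessive_gap_step[where lh = "l_hat k" and z = "x_sub k"] rho_pos tau x_it x_sub l_it_mult
        l_hat_eq it_Suc(1) it_Suc(2)[unfolded rho.simps])
qed

text \<open>
  The weights \<open>(k + 1) (k + 2)\<close> are, up to normalization, the inverses of the products of the
  \<open>\<tau>\<^sub>j\<close>. With them the choice of \<open>\<gamma>\<^sub>k\<close> lets the accumulated error grow only as fast as the weights,
  so that it contributes at most \<open>\<epsilon>/4\<close> to the gap.
\<close>

lemma gap_bound: "(real k + 1) * (real k + 2) * gap k \<le> 2 * gap 0 + \<epsilon> * real k * (real k + 3) / 4"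
proof (induction k)
  case (Suc k)
  have "(real (Suc k) + 1) * (real (Suc k) + 2) * gap (Suc k)
      \<le> (real k + 2) * (real k + 3) * (tau k * gap k + 2 * gam \<epsilon> k)"
    using mult_left_mono[OF gap_Suc[of k], of "(real k + 2) * (real k + 3)"] by (simp add: algebra_simps)
  also have "\<dots> = (real k + 1) * (real k + 2) * gap k + \<epsilon> * (real k + 2) / 2"
    by (simp add: tau_def gam_def divide_simps) (simp add: algebra_simps)
  also have "\<dots> \<le> 2 * gap 0 + \<epsilon> * real k * (real k + 3) / 4 + \<epsilon> * (real k + 2) / 2"
    using Suc by simp
  also have "\<dots> = 2 * gap 0 + \<epsilon> * real (Suc k) * (real (Suc k) + 3) / 4"
    by (simp add: field_simps)
  finally show ?case .
qed simp

lemma gap_0: "gap 0 \<le> gap_ratio * LD P"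
proof -
  have "gap 0 \<le> Delta P (rho P 0) x0 l0"
    unfolding gap_def it_0 by (intro penalty_gap_le_Delta rho_pos)
  also have "\<dots> \<le> gap_ratio * LD P" using LD_pos by (simp add: gap_ratio_def pos_def)
  finally show ?thesis .
qed

lemma gap_ratio_nonneg: "0 \<le> gap_ratio" using LD_pos by (simp add: gap_ratio_def pos_def)

end

section \<open>Oracle complexity\<close>

text \<open>
  The three constants depend on nothing but \<open>l0\<close>, \<open>ls\<close> and \<open>\<delta>\<close>, the positive part of the initial
  gap divided by \<open>L\<^sub>D\<close>. The first governs the number \<open>sqrt (horizon_const * L\<^sub>D / \<epsilon>)\<close> of outer iterations, the second
  is a uniform bound on all multipliers met until then.
\<close>

definition horizon_const :: "(nat \<Rightarrow> real) \<Rightarrow> real \<Rightarrow> real" where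
  "horizon_const ls \<delta> = 64 * (1 + support_sq_sum ls) + 8 * \<delta>"

definition multiplier_const :: "(nat \<Rightarrow> real) \<Rightarrow> (nat \<Rightarrow> real) \<Rightarrow> real \<Rightarrow> real" where
  "multiplier_const l0 ls \<delta> = horizon_const ls \<delta> + (\<Sum>i | l0 i \<noteq> 0. l0 i)"

definition complexity_const :: "(nat \<Rightarrow> real) \<Rightarrow> (nat \<Rightarrow> real) \<Rightarrow> real \<Rightarrow> real" where
  "complexity_const l0 ls \<delta>
     = 4 * sqrt (horizon_const ls \<delta>) * (2 + 3 * sqrt (2 * multiplier_const l0 ls \<delta>))"

lemma length_history: "length (history P A l t) = t * (nc P + 1)"
  by (induction t) (auto simp: grad_queries_def)

lemma support_sq_sum_nonneg: "0 \<le> support_sq_sum l"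
  by (simp add: support_sq_sum_def sum_nonneg)

context ipds_run
begin

abbreviation "Q \<equiv> horizon_const ls gap_ratio"
abbreviation "B \<equiv> multiplier_const l0 ls gap_ratio"
abbreviation "\<Lambda> \<equiv> support_sq_sum ls"

lemma Q_ge: "64 \<le> Q" "64 * \<Lambda> \<le> Q" "8 * gap_ratio \<le> Q"
  using support_sq_sum_nonneg[of ls] gap_ratio_nonneg by (auto simp: horizon_const_def)

lemma l0_le: "0 \<le> (\<Sum>i | l0 i \<noteq> 0. l0 i)" "l0 i \<le> (\<Sum>i | l0 i \<noteq> 0. l0 i)"
proof -
  have eq: "(\<Sum>i | l0 i \<noteq> 0. l0 i) = (\<Sum>i=1..nc P. l0 i)"
    using support_sum_multipliers[OF l0, of "\<lambda>a. a"] by simp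
  show nn: "0 \<le> (\<Sum>i | l0 i \<noteq> 0. l0 i)"
    unfolding eq using l0 by (intro sum_nonneg) (auto simp: multipliers_def)
  show "l0 i \<le> (\<Sum>i | l0 i \<noteq> 0. l0 i)"
  proof (cases "i \<in> {1..nc P}")
    case True
    then show ?thesis unfolding eq using l0 by (intro member_le_sum) (auto simp: multipliers_def)
  next
    case False
    then show ?thesis using l0 nn by (simp add: multipliers_def)
  qed
qed

lemma Q_le_B: "Q \<le> B" using l0_le(1) by (simp add: multiplier_const_def)

text \<open>
  At the horizon the gap is at most \<open>\<epsilon>/2\<close>, and \<open>\<rho>\<^sub>K\<close> and \<open>\<rho>\<^sub>K \<parallel>l\<^sup>*\<parallel>\<^sup>2\<close> are at most \<open>\<epsilon>/4\<close>, so that the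
  square of the violation is at most \<open>\<epsilon>\<^sup>2\<close>.
\<close>

lemma eps_solution_x_it:
  assumes K: "Q * LD P \<le> \<epsilon> * (real K)\<^sup>2"
  shows "eps_solution P xs \<epsilon> (x_it K)"
proof -
  define w where "w = (real K + 1) * (real K + 2)"
  have w: "0 < w" "(real K)\<^sup>2 \<le> w" "real K * (real K + 3) \<le> w" "rho P K = 16 * LD P / w"
    by (simp_all add: w_def rho_eq) (simp_all add: power2_eq_square algebra_simps)
  have Qw: "Q * LD P \<le> \<epsilon> * w" using K w(2) \<epsilon>_pos by (meson mult_left_mono order_trans less_imp_le)
  have "w * gap K \<le> 2 * gap 0 + \<epsilon> * (real K * (real K + 3)) / 4"
    using gap_bound[of K] by (simp add: w_def algebra_simps)
  also have "\<dots> \<le> 2 * (gap_ratio * LD P) + \<epsilon> * w / 4"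
    using gap_0 w(3) \<epsilon>_pos by (intro add_mono mult_left_mono divide_right_mono) auto
  also have "2 * (gap_ratio * LD P) \<le> \<epsilon> * w / 4"
  proof -
    have "8 * gap_ratio * LD P \<le> Q * LD P" using Q_ge(3) LD_pos by (intro mult_right_mono) auto
    then show ?thesis using Qw by linarith
  qed
  finally have "w * gap K \<le> w * (\<epsilon> / 2)" by (simp add: mult.commute)
  then have gapK: "gap K \<le> \<epsilon> / 2" using w(1) by simp
  have "rho P K * (64 * (1 + \<Lambda>)) = 16 * (64 * (1 + \<Lambda>) * LD P) / w" by (simp add: w(4))
  also have "\<dots> \<le> 16 * (\<epsilon> * w) / w"
  proof -
    have "64 * (1 + \<Lambda>) * LD P \<le> Q * LD P"
      using gap_ratio_nonneg LD_pos by (intro mult_right_mono) (auto simp: horizon_const_def)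
    then show ?thesis using Qw w(1) by (intro divide_right_mono) auto
  qed
  also have "\<dots> = 16 * \<epsilon>" using w(1) by simp
  finally have rho: "rho P K * (1 + \<Lambda>) \<le> \<epsilon> / 4" by (simp add: algebra_simps)
  have rho1: "rho P K \<le> \<epsilon> / 4"
    using rho mult_nonneg_nonneg[OF less_imp_le[OF rho_pos[of K]] support_sq_sum_nonneg[of ls]]
    by (simp add: algebra_simps)
  have "obj P (x_it K) \<le> penalty_obj P (rho P K) (x_it K)"
    using rho_pos[of K] by (simp add: penalty_obj_def sum_nonneg)
  then have "obj P (x_it K) - obj P xs \<le> gap K"
    using dual_fun_le_optimal[OF optimal l_it_mult[of K]] by (simp add: gap_def)
  then have "obj P (x_it K) - obj P xs \<le> \<epsilon>" using gapK \<epsilon>_pos by simp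
  moreover have "pos (gc P j (x_it K)) \<le> \<epsilon>" if j: "j \<in> {1..nc P}" for j
  proof (rule power2_le_imp_le)
    have "(pos (gc P j (x_it K)))\<^sup>2 \<le> 4 * rho P K * (gap K + rho P K * \<Lambda>)"
      unfolding gap_def by (rule violation_le_gap[OF optimal saddle rho_pos x_it l_it_mult j])
    also have "\<dots> \<le> 4 * rho P K * (\<epsilon> / 2 + \<epsilon> / 4)"
    proof (intro mult_left_mono add_mono gapK)
      show "rho P K * \<Lambda> \<le> \<epsilon> / 4" using rho rho_pos[of K] by (simp add: algebra_simps)
    qed (use rho_pos[of K] in simp)
    also have "\<dots> \<le> \<epsilon> * \<epsilon>" using mult_right_mono[OF rho1, of \<epsilon>] \<epsilon>_pos by simp
    finally show "(pos (gc P j (x_it K)))\<^sup>2 \<le> \<epsilon>\<^sup>2" by (simp add: power2_eq_square)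
  qed (use \<epsilon>_pos in simp)
  ultimately show ?thesis using x_it by (simp add: eps_solution_def)
qed

text \<open>
  The penalty multipliers \<open>[g\<^sub>i]\<^sub>+ / \<rho>\<^sub>k\<close> stay bounded although \<open>\<rho>\<^sub>k\<close> tends to zero: by the bound on
  the violation their squares are at most \<open>4 (gap\<^sub>k / \<rho>\<^sub>k + \<parallel>l\<^sup>*\<parallel>\<^sup>2)\<close>. In \<open>gap\<^sub>k / \<rho>\<^sub>k\<close> the initial gap
  contributes a constant and the accumulated errors a term of order \<open>\<epsilon> k\<^sup>2 / L\<^sub>D\<close>, which is bounded
  up to the horizon. Hence the smoothness constants of the sub-problems are of order \<open>L + \<alpha>\<close>.
\<close>

lemma lam_tilde_le:
  assumes K: "\<epsilon> * (real K)\<^sup>2 \<le> 4 * Q * LD P" and k: "k \<le> K"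
  shows "lam_tilde P (rho P k) (x_it k) i \<le> Q"
proof (cases "i \<in> {1..nc P}")
  case True
  define w where "w = (real k + 1) * (real k + 2)"
  have w: "0 < w" "rho P k = 16 * LD P / w" by (simp_all add: w_def rho_eq)
  have "w * gap k \<le> 2 * gap 0 + \<epsilon> * (real k * (real k + 3)) / 4"
    using gap_bound[of k] by (simp add: w_def algebra_simps)
  also have "\<dots> \<le> 2 * (gap_ratio * LD P) + \<epsilon> * (4 * (real K)\<^sup>2) / 4"
  proof (intro add_mono mult_left_mono divide_right_mono gap_0)
    have "real k * (real k + 3) \<le> 4 * (real k)\<^sup>2"
      by (cases k) (auto simp: power2_eq_square algebra_simps)
    also have "\<dots> \<le> 4 * (real K)\<^sup>2" using k by (simp add: power_mono)
    finally show "real k * (real k + 3) \<le> 4 * (real K)\<^sup>2" .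
  qed (use \<epsilon>_pos in auto)
  also have "\<dots> \<le> (2 * gap_ratio + 4 * Q) * LD P" using K by (simp add: algebra_simps)
  finally have "w * gap k / LD P \<le> 2 * gap_ratio + 4 * Q"
    using LD_pos by (simp only: pos_divide_le_eq)
  then have "16 * (gap k / rho P k) \<le> 2 * gap_ratio + 4 * Q"
    using LD_pos w(1) by (simp add: w(2) mult.commute)
  then have gap_rho: "4 * (gap k / rho P k) \<le> gap_ratio / 2 + Q" by simp
  have "(lam_tilde P (rho P k) (x_it k) i)\<^sup>2 = (pos (gc P i (x_it k)))\<^sup>2 / (rho P k)\<^sup>2"
    using True by (simp add: lam_tilde_def power_divide)
  also have "\<dots> \<le> 4 * rho P k * (gap k + rho P k * \<Lambda>) / (rho P k)\<^sup>2"
    unfolding gap_def by (intro divide_right_mono violation_le_gap[OF optimal saddle rho_pos x_it l_it_mult True]) simp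
  also have "\<dots> = 4 * (gap k / rho P k) + 4 * \<Lambda>"
  proof -
    have "4 * r * (g + r * \<Lambda>) / r\<^sup>2 = 4 * (g / r) + 4 * \<Lambda>" if "0 < r" for r g :: real
      using that by (simp add: power2_eq_square add_divide_distrib distrib_left)
    then show ?thesis using rho_pos by blast
  qed
  also have "\<dots> \<le> 2 * Q" using gap_rho Q_ge by linarith
  also have "\<dots> \<le> Q\<^sup>2" using Q_ge(1) by (simp add: power2_eq_square)
  finally show ?thesis by (rule power2_le_imp_le) (use Q_ge(1) in simp)
qed (use Q_ge(1) in \<open>auto simp: lam_tilde_def\<close>)

lemma l_it_le:
  assumes K: "\<epsilon> * (real K)\<^sup>2 \<le> 4 * Q * LD P"
  shows "k \<le> K \<Longrightarrow> l_it k i \<le> B"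
proof (induction k)
  case 0
  then show ?case using l0_le(2)[of i] Q_ge(1) by (simp add: it_0 multiplier_const_def)
next
  case (Suc k)
  show ?case unfolding it_Suc(2)
    using Suc tau[of k] lam_tilde_le[OF K Suc.prems, of i] Q_le_B by (intro convex_bound_le) auto
qed

lemma smoothness_le:
  assumes K: "\<epsilon> * (real K)\<^sup>2 \<le> 4 * Q * LD P" and k: "k \<le> K"
  shows "Lf P + Lxx P (l_hat k) \<le> B * (Lf P + alpha P)"
proof -
  have "l_hat k i \<le> B" for i unfolding l_hat_eq
    using tau[of k] lam_tilde_le[OF K k, of i] Q_le_B l_it_le[OF K k, of i] by (intro convex_bound_le) auto
  then have "Lxx P (l_hat k) \<le> (\<Sum>i=1..nc P. B * al P i)"
    unfolding Lxx_def using constraint(1) by (intro sum_mono mult_right_mono) auto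
  moreover have "Lf P \<le> B * Lf P" using Q_ge(1) Q_le_B mu_pos mu_le_Lf by simp
  ultimately show ?thesis by (simp add: alpha_def sum_distrib_left algebra_simps)
qed

lemma length_ipds_calls:
  "length (ipds_calls P A u0 \<epsilon> x0 l0 K) = (\<Sum>k<K. inner_iters k * (nc P + 1))"
  by (simp add: ipds_calls_def length_concat comp_def Let_def length_history inner_iters_def l_hat_def
      interv_sum_list_conv_sum_set_nat atLeast0LessThan)

text \<open>
  The three smallness conditions make the horizon at least one, the logarithm at least one, and
  allow \<open>((L + \<alpha>) / \<epsilon>)\<^sup>3\<close> as reduction factor for every sub-problem. The cube costs a factor 3 in the
  logarithm and swallows the data that the bound must not mention, namely the Bregman
  diameter and \<open>L\<^sub>D\<close>.
\<close>

lemma oracle_calls_le: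
  assumes small: "\<epsilon> \<le> LD P" "\<epsilon> * exp 1 \<le> Lf P + alpha P"
    "16 * B * max breg 1 * Q * LD P * \<epsilon> \<le> (Lf P + alpha P)\<^sup>2"
  shows "\<exists>K. eps_solution P xs \<epsilon> (x_it K) \<and>
    real (length (ipds_calls P A u0 \<epsilon> x0 l0 K))
      \<le> complexity_const l0 ls gap_ratio * (real (nc P) * Msum P / sqrt (mu P * \<epsilon>)
          * sqrt ((Lf P + alpha P) / mu P) * ln ((Lf P + alpha P) / \<epsilon>))"
proof -
  let ?A = "Lf P + alpha P"
  define s where "s = sqrt (Q * LD P / \<epsilon>)"
  define K where "K = nat \<lceil>s\<rceil>"
  define lg where "lg = ln (?A / \<epsilon>)"
  define R where "R = sqrt (?A / mu P)"
  have "1 \<le> Q * (LD P / \<epsilon>)"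
    using mult_mono[of 1 Q 1 "LD P / \<epsilon>"] small(1) Q_ge(1) \<epsilon>_pos by simp
  then have s1: "1 \<le> s" unfolding s_def by simp
  have s2: "s\<^sup>2 = Q * LD P / \<epsilon>" unfolding s_def using Q_ge(1) LD_pos \<epsilon>_pos by simp
  have Ks: "s \<le> real K" "real K \<le> 2 * s" "1 \<le> K" unfolding K_def using s1 by linarith+
  have "Q * LD P = \<epsilon> * s\<^sup>2" using s2 \<epsilon>_pos by simp
  also have "\<dots> \<le> \<epsilon> * (real K)\<^sup>2" using Ks s1 \<epsilon>_pos by (intro mult_left_mono power_mono) auto
  finally have sol: "eps_solution P xs \<epsilon> (x_it K)" by (rule eps_solution_x_it)
  have "\<epsilon> * (real K)\<^sup>2 \<le> \<epsilon> * (2 * s)\<^sup>2" using Ks s1 \<epsilon>_pos by (intro mult_left_mono power_mono) auto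
  also have "\<dots> = 4 * Q * LD P" using s2 \<epsilon>_pos by (simp add: power_mult_distrib)
  finally have K4: "\<epsilon> * (real K)\<^sup>2 \<le> 4 * Q * LD P" .
  have A_pos: "0 < ?A" "mu P \<le> ?A" using alpha_nonneg mu_pos mu_le_Lf by auto
  have Ae: "exp 1 \<le> ?A / \<epsilon>" using small(2) \<epsilon>_pos by (simp add: field_simps)
  have l1: "1 \<le> lg" unfolding lg_def using Ae A_pos \<epsilon>_pos by (subst ln_ge_iff) auto
  have R1: "1 \<le> R" unfolding R_def using A_pos mu_pos by simp
  have B0: "0 < B" using Q_ge(1) Q_le_B by simp
  have inner: "real (inner_iters k) \<le> (2 + 3 * sqrt (2 * B)) * R * lg" if k: "k < K" for k
  proof -
    let ?E = "(?A / \<epsilon>) ^ 3"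
    have L'0: "0 \<le> Lf P + Lxx P (l_hat k)"
      using mu_pos mu_le_Lf Lxx_nonneg[OF l_hat_mult, of k] by simp
    have L': "Lf P + Lxx P (l_hat k) \<le> B * ?A" using smoothness_le[OF K4] k by simp
    have E1: "1 \<le> ?E" using Ae one_le_exp_iff[of 1] by (intro one_le_power) linarith
    have "real k + 3 \<le> 4 * (real K)\<^sup>2"
    proof -
      have "real k + 3 \<le> 4 * real K" using k by linarith
      also have "\<dots> \<le> 4 * (real K)\<^sup>2" using Ks(3) by (simp add: power2_eq_square)
      finally show ?thesis .
    qed
    then have "\<epsilon> * (real k + 3) \<le> 16 * Q * LD P"
      using K4 mult_left_mono[of "real k + 3" "4 * (real K)\<^sup>2" \<epsilon>] \<epsilon>_pos by linarith
    then have "B * max breg 1 * \<epsilon> * (\<epsilon> * (real k + 3)) \<le> B * max breg 1 * \<epsilon> * (16 * Q * LD P)"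
      using B0 \<epsilon>_pos by (intro mult_left_mono) auto
    also have "\<dots> \<le> ?A\<^sup>2" using small(3) by (simp add: mult_ac)
    finally have key: "B * max breg 1 * (\<epsilon>\<^sup>2 * (real k + 3)) \<le> ?A\<^sup>2"
      by (simp add: power2_eq_square mult_ac)
    have "(Lf P + Lxx P (l_hat k)) * breg / 4 \<le> B * ?A * max breg 1 / 4"
    proof -
      have "(Lf P + Lxx P (l_hat k)) * breg \<le> (Lf P + Lxx P (l_hat k)) * max breg 1"
        using L'0 by (intro mult_left_mono) auto
      also have "\<dots> \<le> B * ?A * max breg 1" using L' by (intro mult_right_mono) auto
      finally show ?thesis by simp
    qed
    also have "\<dots> \<le> gam \<epsilon> k * ?E"
    proof -
      have "B * max breg 1 \<le> ?A\<^sup>2 / \<epsilon>\<^sup>2 / (real k + 3)"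
        using key \<epsilon>_pos by (simp add: pos_le_divide_eq)
      then have "?A / 4 * (B * max breg 1) \<le> ?A / 4 * (?A\<^sup>2 / \<epsilon>\<^sup>2 / (real k + 3))"
        using A_pos by (intro mult_left_mono) auto
      also have "\<dots> = gam \<epsilon> k * ?E"
      proof -
        have "a / 4 * (a\<^sup>2 / \<epsilon>\<^sup>2 / c) = \<epsilon> / (4 * c) * (a / \<epsilon>) ^ 3" for a c :: real
          using \<epsilon>_pos by (simp add: power_divide power2_eq_square power3_eq_cube)
        then show ?thesis unfolding gam_def .
      qed
      finally show ?thesis by (simp add: mult_ac)
    qed
    finally have "real (inner_iters k) \<le> 2 + sqrt (2 * ((Lf P + Lxx P (l_hat k)) / mu P)) * ln ?E"
      by (rule inner_iters_bound[OF E1])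
    also have "ln ?E = 3 * lg" using A_pos \<epsilon>_pos by (simp add: lg_def ln_realpow)
    also have "sqrt (2 * ((Lf P + Lxx P (l_hat k)) / mu P)) \<le> sqrt (2 * B) * R"
    proof -
      have "2 * ((Lf P + Lxx P (l_hat k)) / mu P) \<le> 2 * (B * ?A / mu P)"
        using L' mu_pos by (intro mult_left_mono divide_right_mono) auto
      then show ?thesis by (simp add: R_def real_sqrt_mult[symmetric] mult.assoc)
    qed
    finally have "real (inner_iters k) \<le> 2 + sqrt (2 * B) * R * (3 * lg)" using l1 by simp
    moreover have "1 \<le> R * lg" using mult_mono[OF R1 l1] R1 by simp
    ultimately show ?thesis by (simp add: algebra_simps)
  qed
  have "real (length (ipds_calls P A u0 \<epsilon> x0 l0 K)) = (\<Sum>k<K. real (inner_iters k) * (real (nc P) + 1))"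
    by (simp add: length_ipds_calls distrib_left add.commute)
  also have "\<dots> \<le> (\<Sum>k<K. ((2 + 3 * sqrt (2 * B)) * R * lg) * (2 * real (nc P)))"
    using inner nc_ge_1 R1 l1 B0 by (intro sum_mono mult_mono) auto
  also have "\<dots> = real K * (((2 + 3 * sqrt (2 * B)) * R * lg) * (2 * real (nc P)))" by simp
  also have "\<dots> \<le> (2 * s) * (((2 + 3 * sqrt (2 * B)) * R * lg) * (2 * real (nc P)))"
    using Ks R1 l1 B0 by (intro mult_right_mono mult_nonneg_nonneg) auto
  also have "s = sqrt Q * (Msum P / sqrt (mu P * \<epsilon>))"
  proof -
    have "Q * LD P / \<epsilon> = Q * ((Msum P)\<^sup>2 / (mu P * \<epsilon>))" by (simp add: LD_def)
    then show ?thesis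
      using Msum_nonneg by (simp only: s_def real_sqrt_mult real_sqrt_divide real_sqrt_abs abs_of_nonneg)
  qed
  also have "2 * (sqrt Q * (Msum P / sqrt (mu P * \<epsilon>)))
        * (((2 + 3 * sqrt (2 * B)) * R * lg) * (2 * real (nc P)))
      = complexity_const l0 ls gap_ratio * (real (nc P) * Msum P / sqrt (mu P * \<epsilon>) * R * lg)"
  proof -
    have "2 * (q * (m / r)) * ((b * R * lg) * (2 * n)) = 4 * q * b * (n * m / r * R * lg)"
      for q m r b n :: real by simp
    then show ?thesis unfolding complexity_const_def .
  qed
  finally show ?thesis using sol unfolding R_def lg_def by blast
qed

lemma C_det_le:
  assumes "eps_solution P xs \<epsilon> (x_it K)"
  shows "C_det P A u0 xs x0 l0 \<epsilon> \<le> enat (length (ipds_calls P A u0 \<epsilon> x0 l0 K))"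
  unfolding C_det_def using assms by (intro INF_lower) (simp add: x_it_def)

end

theorem theorem5p6:
  shows "\<exists>C :: (nat \<Rightarrow> real) \<Rightarrow> (nat \<Rightarrow> real) \<Rightarrow> real \<Rightarrow> real.
    \<forall>(P :: 'v::real_inner problem) A u0 xs ls x0 l0.
      valid_problem P \<and> LD P > 0 \<and>
      optimal P xs \<and> saddle_point P xs ls \<and>
      u0 \<in> X_int P \<and> apg_guarantee P A u0 \<and>
      x0 \<in> Xs P \<and> l0 \<in> multipliers P
      \<longrightarrow> (\<exists>\<epsilon>0>0. \<forall>\<epsilon>. 0 < \<epsilon> \<and> \<epsilon> < \<epsilon>0 \<longrightarrow>
            ereal_of_enat (C_det P A u0 xs x0 l0 \<epsilon>)
              \<le> ereal (C l0 ls (pos (Delta P (rho P 0) x0 l0) / LD P)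
                  * (real (nc P) * Msum P / sqrt (mu P * \<epsilon>)
                     * sqrt ((Lf P + alpha P) / mu P)
                     * ln ((Lf P + alpha P) / \<epsilon>))))"
proof (rule exI[of _ complexity_const], intro allI impI, elim conjE)
  fix P :: "'v problem" and A u0 xs ls x0 l0
  assume *: "valid_problem P" "LD P > 0" "optimal P xs" "saddle_point P xs ls"
    "apg_guarantee P A u0" "x0 \<in> Xs P" "l0 \<in> multipliers P"
  define d where "d = pos (Delta P (rho P 0) x0 l0) / LD P"
  define Z where "Z = 16 * multiplier_const l0 ls d * max (bregman_max (Es P) (Xs P) (dg P) u0) 1
    * horizon_const ls d * LD P"
  have run: "ipds_run P A u0 xs x0 ls l0 \<epsilon>" if "0 < \<epsilon>" for \<epsilon>
    using * that by unfold_locales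
  (* The value 1 stands for an arbitrary accuracy: only facts that do not involve it are used. *)
  interpret run1: ipds_run P A u0 xs x0 ls l0 1 by (rule run) simp
  have d1: "run1.gap_ratio = d" by (simp add: run1.gap_ratio_def d_def)
  have A_pos: "0 < Lf P + alpha P"
    using run1.alpha_nonneg run1.mu_pos run1.mu_le_Lf by simp
  have "0 < horizon_const ls d" "0 < multiplier_const l0 ls d"
    using run1.Q_ge(1) run1.Q_le_B unfolding d1 by auto
  then have Z_pos: "0 < Z" unfolding Z_def using *(2) by (intro mult_pos_pos) auto
  let ?\<epsilon>0 = "min (LD P) (min ((Lf P + alpha P) / exp 1) ((Lf P + alpha P)\<^sup>2 / Z))"
  have pos: "0 < ?\<epsilon>0" using *(2) A_pos Z_pos by simp
  have main: "ereal_of_enat (C_det P A u0 xs x0 l0 \<epsilon>)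
      \<le> ereal (complexity_const l0 ls d * (real (nc P) * Msum P / sqrt (mu P * \<epsilon>)
          * sqrt ((Lf P + alpha P) / mu P) * ln ((Lf P + alpha P) / \<epsilon>)))"
    if \<epsilon>: "0 < \<epsilon>" "\<epsilon> < ?\<epsilon>0" for \<epsilon>
  proof -
    interpret ipds_run P A u0 xs x0 ls l0 \<epsilon> by (rule run[OF \<epsilon>(1)])
    have d: "gap_ratio = d" by (simp add: gap_ratio_def d_def)
    have "\<epsilon> < (Lf P + alpha P) / exp 1" "\<epsilon> < (Lf P + alpha P)\<^sup>2 / Z" "\<epsilon> < LD P"
      using \<epsilon> by auto
    then have small: "\<epsilon> \<le> LD P" "\<epsilon> * exp 1 \<le> Lf P + alpha P" "Z * \<epsilon> \<le> (Lf P + alpha P)\<^sup>2"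
      using Z_pos by (simp_all add: pos_less_divide_eq mult.commute)
    obtain K where K: "eps_solution P xs \<epsilon> (x_it K)"
      "real (length (ipds_calls P A u0 \<epsilon> x0 l0 K))
        \<le> complexity_const l0 ls d * (real (nc P) * Msum P / sqrt (mu P * \<epsilon>)
          * sqrt ((Lf P + alpha P) / mu P) * ln ((Lf P + alpha P) / \<epsilon>))"
      using oracle_calls_le[unfolded d, OF small[unfolded Z_def]] by blast
    have "ereal_of_enat (C_det P A u0 xs x0 l0 \<epsilon>)
        \<le> ereal_of_enat (enat (length (ipds_calls P A u0 \<epsilon> x0 l0 K)))"
      using C_det_le[OF K(1)] by (simp only: ereal_of_enat_le_iff)
    also have "\<dots> = ereal (real (length (ipds_calls P A u0 \<epsilon> x0 l0 K)))" by simp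
    also have "\<dots> \<le> ereal (complexity_const l0 ls d * (real (nc P) * Msum P / sqrt (mu P * \<epsilon>)
          * sqrt ((Lf P + alpha P) / mu P) * ln ((Lf P + alpha P) / \<epsilon>)))"
      using K(2) by (simp only: ereal_less_eq)
    finally show ?thesis .
  qed
  show "\<exists>\<epsilon>0>0. \<forall>\<epsilon>. 0 < \<epsilon> \<and> \<epsilon> < \<epsilon>0 \<longrightarrow>
            ereal_of_enat (C_det P A u0 xs x0 l0 \<epsilon>)
              \<le> ereal (complexity_const l0 ls (pos (Delta P (rho P 0) x0 l0) / LD P)
                  * (real (nc P) * Msum P / sqrt (mu P * \<epsilon>)
                     * sqrt ((Lf P + alpha P) / mu P)
                     * ln ((Lf P + alpha P) / \<epsilon>)))"
    using pos main unfolding d_def by blast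
qed

end
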